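(* Let $p,q$ be positive integers and $\varphi:[0,+\infty)\to(0,+\infty)$ a non-decreasing unbounded function. Let $f_1,f_2$ be meromorphic functions and $g_1,g_2$ entire functions, and suppose $g_1$, $g_2$ and $g_1\pm g_2$ satisfy the Property (A). Then $$\lambda_{g_1\pm g_2}(f_1\pm f_2)\ge \min\big[\max\{\lambda_{g_1}(f_1),\lambda_{g_1}(f_2)\},\ \max\{\lambda_{g_2}(f_1),\lambda_{g_2}(f_2)\}\big]$$ when the following two conditions hold: (i) $\lambda_{g_1}(f_i)>\lambda_{g_1}(f_j)$ and $f_j$ is of regular relative $(p,q)$-$\varphi$ growth with respect to $g_1$, for some $i,j\in\{1,2\}$, $i\ne j$; (ii) $\lambda_{g_2}(f_i)>\lambda_{g_2}(f_j)$ and $f_j$ is of regular relative $(p,q)$-$\varphi$ growth with respect to $g_2$, for some $i,j\in\{1,2\}$, $i\ne j$. Equality holds when $\lambda_{g_i}(f_1)<\lambda_{g_j}(f_1)$ and $\lambda_{g_i}(f_2)<\lambda_{g_j}(f_2)$ hold simultaneously for some $i,j\in\{1,2\}$, $i\ne j$.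
   Context: Meromorphic and entire functions are on the whole plane $\mathbb{C}$. $M_g(r)=\max_{|z|=r}|g(z)|$, and $T_f(r)$ is the Nevanlinna characteristic function of $f$. For a non-constant entire $g$, $T_g$ is strictly increasing and continuous, with inverse $T_g^{-1}:(|g(0)|,\infty)\to(0,\infty)$, $\lim_{s\to\infty}T_g^{-1}(s)=\infty$. Iterated logarithms: $\log^{[0]}x=x$, $\log^{[k]}x=\log(\log^{[k-1]}x)$ for $k\ge1$. For fixed positive integers $p,q$ and fixed $\varphi$, the relative $(p,q)$-$\varphi$ order and lower order of a meromorphic $f$ with respect to an entire $g$ (full notation $\rho_g^{(p,q)}(f,\varphi)$, $\lambda_g^{(p,q)}(f,\varphi)$, abbreviated $\rho_g(f)$, $\lambda_g(f)$) are the $\limsup$ and the $\liminf$, respectively, as $r\to\infty$ of $\dfrac{\log^{[p]}T_g^{-1}(T_f(r))}{\log^{[q]}\varphi(r)}$. $f$ is of regular relative $(p,q)$-$\varphi$ growth with respect to $g$ if $\rho_g(f)=\lambda_g(f)$. A non-constant entire $g$ has the Property (A) if for every $\sigma>1$ and all sufficiently large $r$, $[M_g(r)]^2\le M_g(r^\sigma)$. Standing assumption: all growth indicators that occur are nonzero and finite. The symbol $\pm$ means either choice of sign, the same choice at every occurrence of the same expression (the sign in $f_1\pm f_2$ and the sign in $g_1\pm g_2$ need not coincide). *)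

theory Defs
  imports "HOL-Complex_Analysis.Complex_Analysis"
begin

definition log_plus :: "real \<Rightarrow> real" where
  "log_plus x = max 0 (ln x)"

definition pole_count :: "(complex \<Rightarrow> complex) \<Rightarrow> real \<Rightarrow> nat" where
  "pole_count f t = (\<Sum>z\<in>{z \<in> cball 0 t. is_pole f z}. nat (- zorder f z))"

definition nev_counting :: "(complex \<Rightarrow> complex) \<Rightarrow> real \<Rightarrow> real" where
  "nev_counting f r =
     integral {0..r} (\<lambda>t. (real (pole_count f t) - real (pole_count f 0)) / t)
     + real (pole_count f 0) * ln r"

definition nev_proximity :: "(complex \<Rightarrow> complex) \<Rightarrow> real \<Rightarrow> real" where
  "nev_proximity f r =
     1 / (2 * pi) * integral {0..2 * pi} (\<lambda>\<theta>. log_plus (norm (f (of_real r * cis \<theta>))))"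

text \<open>
  The value of a meromorphic function at its poles (and, more generally, on a set without
  accumulation points) is irrelevant for the characteristic. Only radii r > 0 matter.
\<close>
definition nev_char :: "(complex \<Rightarrow> complex) \<Rightarrow> real \<Rightarrow> real" where
  "nev_char f r = nev_counting f r + nev_proximity f r"

text \<open>
  For a non-constant entire g the characteristic may be constant on an initial interval, for
  instance on (0, 1] when g is the identity; beyond it, it is strictly increasing, so every value
  larger than \<open>log_plus (norm (g 0))\<close> has a unique preimage in (0, \<infinity>). Only such values, in fact
  only arbitrarily large ones, matter for the growth indicators below.
\<close>
definition nev_char_inv :: "(complex \<Rightarrow> complex) \<Rightarrow> real \<Rightarrow> real" where
  "nev_char_inv g = the_inv_into {0<..} (nev_char g)"

definition max_modulus :: "(complex \<Rightarrow> complex) \<Rightarrow> real \<Rightarrow> real" where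
  "max_modulus g r = (SUP z\<in>sphere 0 r. norm (g z))"

text \<open>
  \<open>ln\<close> is total in HOL; since all arguments tend to infinity, the values of iterated logarithms
  outside their natural domain do not affect the upper and lower limits.
\<close>
definition iter_log :: "nat \<Rightarrow> real \<Rightarrow> real" where
  "iter_log k = ln ^^ k"

definition rel_growth_ratio ::
  "nat \<Rightarrow> nat \<Rightarrow> (real \<Rightarrow> real) \<Rightarrow> (complex \<Rightarrow> complex) \<Rightarrow> (complex \<Rightarrow> complex) \<Rightarrow> real \<Rightarrow> real" where
  "rel_growth_ratio p q \<phi> g f r =
     iter_log p (nev_char_inv g (nev_char f r)) / iter_log q (\<phi> r)"

definition rel_order ::
  "nat \<Rightarrow> nat \<Rightarrow> (real \<Rightarrow> real) \<Rightarrow> (complex \<Rightarrow> complex) \<Rightarrow> (complex \<Rightarrow> complex) \<Rightarrow> ereal" where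
  "rel_order p q \<phi> g f = Limsup at_top (\<lambda>r. ereal (rel_growth_ratio p q \<phi> g f r))"

definition rel_lower_order ::
  "nat \<Rightarrow> nat \<Rightarrow> (real \<Rightarrow> real) \<Rightarrow> (complex \<Rightarrow> complex) \<Rightarrow> (complex \<Rightarrow> complex) \<Rightarrow> ereal" where
  "rel_lower_order p q \<phi> g f = Liminf at_top (\<lambda>r. ereal (rel_growth_ratio p q \<phi> g f r))"

definition regular_rel_growth ::
  "nat \<Rightarrow> nat \<Rightarrow> (real \<Rightarrow> real) \<Rightarrow> (complex \<Rightarrow> complex) \<Rightarrow> (complex \<Rightarrow> complex) \<Rightarrow> bool" where
  "regular_rel_growth p q \<phi> g f \<longleftrightarrow> rel_order p q \<phi> g f = rel_lower_order p q \<phi> g f"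

definition property_A :: "(complex \<Rightarrow> complex) \<Rightarrow> bool" where
  "property_A g \<longleftrightarrow>
     g holomorphic_on UNIV \<and> \<not> g constant_on UNIV \<and>
     (\<forall>\<sigma>>1. \<forall>\<^sub>F r in at_top. (max_modulus g r)\<^sup>2 \<le> max_modulus g (r powr \<sigma>))"

definition finite_nonzero :: "ereal \<Rightarrow> bool" where
  "finite_nonzero x \<longleftrightarrow> x \<noteq> 0 \<and> \<bar>x\<bar> \<noteq> \<infinity>"

end

theory Submission
  imports Defs "HOL-Real_Asymp.Real_Asymp"
begin

text \<open>
  Put \<open>L r = iter_log q (\<phi> r)\<close> and let \<open>E\<close> be the \<open>p\<close>-fold exponential. For an entire \<open>g\<close> of unbounded
  characteristic, the growth ratio of \<open>f\<close> exceeds \<open>c > 0\<close> at a large \<open>r\<close> iff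
  \<open>T\<^sub>g (E (c * L r)) < T\<^sub>f r\<close>. If \<open>g\<close> has Property (A), then \<open>T\<^sub>g (r powr \<sigma>) / T\<^sub>g r\<close> tends to infinity for
  every \<open>\<sigma> > 1\<close>, so for \<open>c < d\<close> the level \<open>T\<^sub>g (E (d * L r))\<close> dominates any multiple of
  \<open>T\<^sub>g (E (c * L r))\<close>. Both the sum in \<open>f\<close> and the sum in \<open>g\<close> are then handled by
  \<open>T (u \<plusminus> v) \<le> T u + T v + ln 2\<close>: first the relative lower orders of \<open>f\<^sub>1 \<plusminus> f\<^sub>2\<close> with respect to \<open>g\<^sub>1\<close> and
  \<open>g\<^sub>2\<close> are the two maxima, then the one with respect to \<open>g\<^sub>1 \<plusminus> g\<^sub>2\<close> is compared with their minimum.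

  The facts about \<open>T\<close> for entire functions (monotonicity, convexity in \<open>ln r\<close> in midpoint form,
  \<open>log_plus (M r) \<le> 3 * T (2 * r)\<close>) are obtained without potential theory: the circle mean of
  \<open>log_plus \<bar>g\<bar>\<close> is a uniform limit of averages over rotations of \<open>g\<close>, and such averages are maxima of
  logarithms of moduli of holomorphic functions.
\<close>

section \<open>Maximum principle and circle means for sums of \<open>log_plus\<close>\<close>

lemma log_plus_nonneg [simp]: "0 \<le> log_plus x"
  by (simp add: log_plus_def)

lemma log_plus_eq_ln_max: "0 \<le> x \<Longrightarrow> log_plus x = ln (max 1 x)"
  by (cases "x = 0") (auto simp: log_plus_def max_def)

lemma log_plus_mono: "0 \<le> x \<Longrightarrow> x \<le> y \<Longrightarrow> log_plus x \<le> log_plus y"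
  by (auto simp: log_plus_eq_ln_max)

lemma log_plus_eq_0: "0 \<le> x \<Longrightarrow> x \<le> 1 \<Longrightarrow> log_plus x = 0"
  by (simp add: log_plus_eq_ln_max)

lemma log_plus_eq_ln: "1 \<le> x \<Longrightarrow> log_plus x = ln x"
  by (simp add: log_plus_eq_ln_max)

lemma le_exp_log_plus: "0 \<le> x \<Longrightarrow> x \<le> exp (log_plus x)"
  by (simp add: log_plus_eq_ln_max less_max_iff_disj)

text \<open>This is \<open>max 1 (x + y) \<le> 2 * max 1 x * max 1 y\<close> after taking
  logarithms.\<close>

lemma log_plus_add_le:
  assumes "0 \<le> x" "0 \<le> y"
  shows "log_plus (x + y) \<le> log_plus x + log_plus y + ln 2"
proof -
  have "max 1 (x + y) \<le> max 1 x * max 1 y * 2"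
  proof -
    have "1 \<le> max 1 x" "1 \<le> max 1 y" by auto
    then have "max 1 x \<le> max 1 x * max 1 y" "max 1 y \<le> max 1 x * max 1 y"
      by (auto simp: mult_le_cancel_left1 mult_le_cancel_right1)
    then have "max 1 x + max 1 y \<le> max 1 x * max 1 y * 2" by linarith
    moreover have "x + y \<le> max 1 x + max 1 y" "1 \<le> max 1 x + max 1 y" by auto
    ultimately show ?thesis by linarith
  qed
  moreover have "0 < max 1 x" "0 < max 1 y" "0 < max 1 (x + y)" by auto
  ultimately have "ln (max 1 (x + y)) \<le> ln (max 1 x * max 1 y * 2)"
    by (simp only: ln_le_cancel_iff mult_pos_pos zero_less_numeral)
  also have "\<dots> = ln (max 1 x) + ln (max 1 y) + ln 2"
  proof -
    have "max 1 x * max 1 y \<noteq> 0" "max 1 x \<noteq> 0" "max 1 y \<noteq> 0" by (auto simp: max_def)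
    then show ?thesis by (simp only: ln_mult) simp
  qed
  finally show ?thesis using assms by (simp add: log_plus_eq_ln_max)
qed

lemma continuous_on_log_plus_norm:
  assumes "continuous_on S h"
  shows "continuous_on S (\<lambda>x. log_plus (norm (h x)))"
  unfolding log_plus_eq_ln_max[OF norm_ge_zero]
  using assms by (intro continuous_intros) (auto simp: max_def)

text \<open>A sum of functions \<open>log_plus \<bar>h j\<bar>\<close> equals \<open>ln\<close> of the largest of the moduli of the
  products of subfamilies of the \<open>h j\<close>, so it inherits the maximum principle.\<close>
lemma sum_log_plus_maximum_principle:
  fixes h :: "'a \<Rightarrow> complex \<Rightarrow> complex"
  assumes "finite J" "open U" "bounded U"
    and "\<And>j. j \<in> J \<Longrightarrow> h j holomorphic_on U"
    and "\<And>j. j \<in> J \<Longrightarrow> continuous_on (closure U) (h j)"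
    and K: "\<And>z. z \<in> frontier U \<Longrightarrow> (\<Sum>j\<in>J. log_plus (norm (h j z))) \<le> K"
    and "z \<in> U"
  shows "(\<Sum>j\<in>J. log_plus (norm (h j z))) \<le> K"
proof -
  \<comment> \<open>The subfamily depends on the fixed point \<open>z\<close> and gives the full sum
    there, because the omitted terms vanish. On the frontier the product over any subfamily is
    controlled by the full sum, because all terms are nonnegative.\<close>
  define S where "S = {j\<in>J. norm (h j z) \<ge> 1}"
  have S: "finite S" "S \<subseteq> J" using assms(1) by (auto simp: S_def)
  have bound: "norm (\<Prod>j\<in>S. h j w) \<le> exp K" if "w \<in> frontier U" for w
  proof -
    have "norm (\<Prod>j\<in>S. h j w) \<le> (\<Prod>j\<in>S. exp (log_plus (norm (h j w))))"
      unfolding prod_norm[symmetric]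
      by (intro prod_mono) (simp add: le_exp_log_plus)
    also have "\<dots> = exp (\<Sum>j\<in>S. log_plus (norm (h j w)))"
      using S by (simp add: exp_sum)
    also have "\<dots> \<le> exp (\<Sum>j\<in>J. log_plus (norm (h j w)))"
      using S assms(1) by (auto intro!: sum_mono2)
    also have "\<dots> \<le> exp K" using K[OF that] by simp
    finally show ?thesis .
  qed
  have *: "norm (\<Prod>j\<in>S. h j z) \<le> exp K"
  proof (rule maximum_modulus_frontier[of "\<lambda>z. \<Prod>j\<in>S. h j z" U])
    show "(\<lambda>z. \<Prod>j\<in>S. h j z) holomorphic_on interior U"
      unfolding interior_open[OF assms(2)]
      by (rule holomorphic_on_prod) (use assms(4) S in blast)
    show "continuous_on (closure U) (\<lambda>z. \<Prod>j\<in>S. h j z)"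
      by (rule continuous_on_prod) (use assms(5) S in blast)
  qed (use assms bound in auto)
  have "(\<Sum>j\<in>J. log_plus (norm (h j z))) = (\<Sum>j\<in>S. log_plus (norm (h j z)))"
    using assms(1) by (intro sum.mono_neutral_right)
       (auto simp: S_def, meson linear log_plus_eq_0 norm_ge_zero)
  also have "\<dots> = (\<Sum>j\<in>S. ln (norm (h j z)))"
    by (intro sum.cong) (auto simp: S_def log_plus_eq_ln)
  also have "\<dots> = ln (norm (\<Prod>j\<in>S. h j z))"
    unfolding prod_norm[symmetric] by (rule ln_prod[symmetric]) (use S in \<open>auto simp: S_def\<close>)
  also have "\<dots> \<le> K"
  proof -
    have "norm (\<Prod>j\<in>S. h j z) > 0"
      using S by (auto simp: S_def)
    then show ?thesis using * by (metis ln_exp ln_le_cancel_iff exp_gt_zero)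
  qed
  finally show ?thesis .
qed


section \<open>Riemann sums of periodic functions and rotation means\<close>

lemma integral_periodic_shift:
  fixes v :: "real \<Rightarrow> real"
  assumes v: "continuous_on UNIV v" and per: "\<And>x. v (x + c) = v x" and "\<bar>a\<bar> \<le> c"
  shows "integral {a..a + c} v = integral {0..c} v"
proof -
  have i: "v integrable_on {x..y}" for x y
    using continuous_on_subset[OF v] by (intro integrable_continuous_interval) auto
  have shift: "integral {x..y} v = integral {x + c..y + c} v" for x y
    using integral_shift[of x c y v] continuous_on_subset[OF v] by (simp add: o_def per)
  \<comment> \<open>The part beyond \<open>c\<close> is a shifted copy of \<open>{0..a}\<close>. A
    negative \<open>a\<close> is later moved up by one period.\<close>
  have pos: "integral {a..a + c} v = integral {0..c} v" if "0 \<le> a" "a \<le> c" for a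
  proof -
    have "integral {a..c} v + integral {c..a + c} v = integral {a..a + c} v"
      using that by (intro Henstock_Kurzweil_Integration.integral_combine i) auto
    moreover have "integral {0..a} v + integral {a..c} v = integral {0..c} v"
      using that by (intro Henstock_Kurzweil_Integration.integral_combine i) auto
    ultimately show ?thesis using shift[of 0 a] by simp
  qed
  show ?thesis
  proof (cases "0 \<le> a")
    case False
    then show ?thesis using shift[of a "a + c"] pos[of "a + c"] assms(3) by (simp add: add.commute)
  qed (use pos assms(3) in auto)
qed

text \<open>Uniform continuity on \<open>{0..4*pi}\<close>, which contains all nodes for every
  \<open>a\<close> in \<open>{0..2*pi}\<close>, makes the choice of \<open>N\<close> independent of
  the starting point \<open>a\<close>.\<close>

lemma periodic_riemann_sums:
  fixes v :: "real \<Rightarrow> real"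
  assumes v: "continuous_on UNIV v" and per: "\<And>x. v (x + 2 * pi) = v x" and e: "e > 0"
  shows "\<forall>\<^sub>F N in sequentially. \<forall>a\<in>{0..2*pi}.
    \<bar>(\<Sum>j<N. v (a + 2 * pi * real j / real N)) / N - 1 / (2 * pi) * integral {0..2*pi} v\<bar> \<le> e"
proof -
  have i: "v integrable_on {x..y}" for x y
    using continuous_on_subset[OF v] by (intro integrable_continuous_interval) auto
  have "uniformly_continuous_on {0..4*pi} v"
    using continuous_on_subset[OF v] by (intro compact_uniformly_continuous) auto
  then obtain d where d: "d > 0"
    "\<And>x y. x \<in> {0..4*pi} \<Longrightarrow> y \<in> {0..4*pi} \<Longrightarrow> \<bar>y - x\<bar> < d \<Longrightarrow> \<bar>v y - v x\<bar> < e"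
    using e unfolding uniformly_continuous_on_def dist_real_def by metis
  have "\<forall>\<^sub>F N in sequentially. 2 * pi / d < real N"
    using filterlim_real_sequentially by (simp add: filterlim_at_top_dense)
  then show ?thesis
    using eventually_gt_at_top[of 0]
  proof eventually_elim
    case (elim N)
    define s where "s = 2 * pi / N"
    have s: "s > 0" "s < d" "N * s = 2 * pi" using elim d(1) by (auto simp: s_def field_simps)
    show ?case
    proof
      fix a assume a: "a \<in> {0..2*pi}"
      define x where "x = (\<lambda>j. a + real j * s)"
      have xs: "x (Suc j) = x j + s" for j by (simp add: x_def algebra_simps)
      have x0: "x 0 = a" "x N = a + 2 * pi" using s by (auto simp: x_def)
      have xr: "x j \<in> {0..4*pi}" if "j \<le> N" for j
      proof -
        have "real j * s \<le> N * s" using that s by (intro mult_right_mono) auto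
        then show ?thesis using a s by (auto simp: x_def)
      qed
      have split: "integral {a..x n} v = (\<Sum>j<n. integral {x j..x (Suc j)} v)" for n
      proof (induction n)
        case (Suc n)
        have "integral {a..x n} v + integral {x n..x (Suc n)} v = integral {a..x (Suc n)} v"
          using s by (intro Henstock_Kurzweil_Integration.integral_combine i) (auto simp: x_def)
        then show ?case using Suc by simp
      qed (simp add: x0)
      have piece: "\<bar>integral {x j..x (Suc j)} v - s * v (x j)\<bar> \<le> s * e" if "j < N" for j
      proof -
        have "integral {x j..x (Suc j)} v - s * v (x j) = integral {x j..x (Suc j)} (\<lambda>t. v t - v (x j))"
          using s by (subst Henstock_Kurzweil_Integration.integral_diff) (auto simp: xs i)
        moreover have "norm (integral {x j..x (Suc j)} (\<lambda>t. v t - v (x j))) \<le> e * (x (Suc j) - x j)"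
        proof (rule integral_bound)
          show "continuous_on {x j..x (Suc j)} (\<lambda>t. v t - v (x j))"
            by (intro continuous_intros continuous_on_subset[OF v]) auto
          fix t assume t: "t \<in> {x j..x (Suc j)}"
          have "t \<in> {0..4*pi}" "x j \<in> {0..4*pi}" using xr[of j] xr[of "Suc j"] t that by auto
          moreover have "\<bar>t - x j\<bar> < d" using t s by (auto simp: xs)
          ultimately show "norm (v t - v (x j)) \<le> e" using d(2)[of "x j" t] by simp
        qed (use s in \<open>simp add: xs\<close>)
        ultimately show ?thesis by (simp add: xs mult.commute)
      qed
      have "\<bar>integral {a..a + 2*pi} v - (\<Sum>j<N. s * v (x j))\<bar> \<le> (\<Sum>j<N. s * e)"
        unfolding x0(2)[symmetric] split sum_subtractf[symmetric]
        by (rule order_trans[OF sum_abs sum_mono]) (use piece in auto)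
      also have "(\<Sum>j<N. s * e) = 2 * pi * e" using s by simp
      finally have *: "\<bar>integral {0..2*pi} v - s * (\<Sum>j<N. v (x j))\<bar> \<le> 2 * pi * e"
        using integral_periodic_shift[OF v per] a by (simp add: sum_distrib_left)
      have "2 * pi * \<bar>(\<Sum>j<N. v (x j)) / N - 1 / (2 * pi) * integral {0..2*pi} v\<bar>
          = \<bar>integral {0..2*pi} v - s * (\<Sum>j<N. v (x j))\<bar>"
      proof -
        have "2 * pi * \<bar>(\<Sum>j<N. v (x j)) / N - 1 / (2 * pi) * integral {0..2*pi} v\<bar>
          = \<bar>2 * pi * ((\<Sum>j<N. v (x j)) / N - 1 / (2 * pi) * integral {0..2*pi} v)\<bar>"
          by (simp add: abs_mult)
        also have "2 * pi * ((\<Sum>j<N. v (x j)) / N - 1 / (2 * pi) * integral {0..2*pi} v)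
          = - (integral {0..2*pi} v - s * (\<Sum>j<N. v (x j)))"
          using elim by (simp add: s_def field_simps)
        finally show ?thesis by simp
      qed
      with * have "2 * pi * \<bar>(\<Sum>j<N. v (x j)) / N - 1 / (2 * pi) * integral {0..2*pi} v\<bar> \<le> 2 * pi * e"
        by simp
      then have "\<bar>(\<Sum>j<N. v (x j)) / N - 1 / (2 * pi) * integral {0..2*pi} v\<bar> \<le> e"
        by (subst (asm) mult_le_cancel_left_pos) auto
      moreover have "(\<Sum>j<N. v (x j)) = (\<Sum>j<N. v (a + 2 * pi * real j / real N))"
        by (simp add: x_def s_def mult.commute mult.left_commute)
      ultimately show "\<bar>(\<Sum>j<N. v (a + 2 * pi * real j / real N)) / N
          - 1 / (2 * pi) * integral {0..2*pi} v\<bar> \<le> e" by simp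
    qed
  qed
qed

text \<open>A Riemann sum for the circle mean, with nodes at the regular \<open>N\<close>-gon
  through \<open>z\<close>. As a function of \<open>z\<close> it is a multiple of a sum to which the
  maximum principle applies.\<close>

definition rotation_mean :: "(complex \<Rightarrow> complex) \<Rightarrow> nat \<Rightarrow> complex \<Rightarrow> real" where
  "rotation_mean g N z = (\<Sum>j<N. log_plus (norm (g (cis (2 * pi * real j / real N) * z)))) / real N"

lemma circle_in_sphere: "0 \<le> r \<Longrightarrow> of_real r * cis \<theta> \<in> sphere 0 r"
  by (simp add: norm_mult)

lemma sphere_eq_cis:
  assumes "z \<in> sphere 0 r"
  obtains a where "a \<in> {0..2*pi}" "z = of_real r * cis a"
proof -
  have "z = of_real (norm z) * cis (Arg2pi z)"
    using Arg2pi[of z] by (simp add: cis_conv_exp is_Arg_def)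
  then show ?thesis using that[of "Arg2pi z"] assms Arg2pi[of z] by auto
qed

lemma cis_add_2pi: "cis (x + 2 * pi) = cis x"
  by (simp add: cis.ctr)

lemma continuous_on_circle:
  assumes "continuous_on (sphere 0 r) g" "0 \<le> r"
  shows "continuous_on S (\<lambda>\<theta>. log_plus (norm (g (of_real r * cis \<theta>))))"
proof (intro continuous_on_log_plus_norm)
  have "(\<lambda>\<theta>. of_real r * cis \<theta>) ` S \<subseteq> sphere 0 r" using circle_in_sphere assms(2) by blast
  then show "continuous_on S (\<lambda>\<theta>. g (of_real r * cis \<theta>))"
    by (intro continuous_on_compose2[OF assms(1)] continuous_intros)
qed

text \<open>Uniformity over the starting angle becomes uniformity over the point \<open>z\<close> of
  the circle.\<close>

lemma rotation_mean_approximates: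
  assumes "continuous_on (sphere 0 r) g" "0 \<le> r" "e > 0"
  shows "\<forall>\<^sub>F N in sequentially. \<forall>z\<in>sphere 0 r. \<bar>rotation_mean g N z - nev_proximity g r\<bar> \<le> e"
proof -
  let ?v = "\<lambda>\<theta>. log_plus (norm (g (of_real r * cis \<theta>)))"
  have "\<forall>\<^sub>F N in sequentially. \<forall>a\<in>{0..2*pi}.
    \<bar>(\<Sum>j<N. ?v (a + 2 * pi * real j / real N)) / N - 1 / (2 * pi) * integral {0..2*pi} ?v\<bar> \<le> e"
    by (intro periodic_riemann_sums continuous_on_circle assms) (simp add: cis_add_2pi)
  then show ?thesis
  proof eventually_elim
    case (elim N)
    show ?case
    proof
      fix z :: complex assume "z \<in> sphere 0 r"
      then obtain a where a: "a \<in> {0..2*pi}" "z = of_real r * cis a" by (rule sphere_eq_cis)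
      have "cis (2 * pi * real j / real N) * z = of_real r * cis (a + 2 * pi * real j / real N)" for j
        unfolding a(2) cis_mult[symmetric] by simp
      then show "\<bar>rotation_mean g N z - nev_proximity g r\<bar> \<le> e"
        using elim a(1) by (simp add: rotation_mean_def nev_proximity_def)
    qed
  qed
qed

lemma le_if_le_add_two_epsilon:
  fixes a b :: real
  assumes "\<And>e. e > 0 \<Longrightarrow> a \<le> b + 2 * e"
  shows "a \<le> b"
proof (rule field_le_epsilon)
  fix e :: real assume "e > 0" then show "a \<le> b + e" using assms[of "e / 2"] by simp
qed

section \<open>Monotonicity and logarithmic convexity of circle means\<close>

text \<open>On the outer circle the rotation mean is uniformly close to
  \<open>nev_proximity g R\<close>. The maximum principle carries this upper bound to a point of the
  inner circle, where the rotation mean is close to \<open>nev_proximity g r\<close>.\<close>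

lemma nev_proximity_mono:
  assumes g: "g holomorphic_on ball 0 R" "continuous_on (cball 0 R) g" and r: "0 \<le> r" "r < R"
  shows "nev_proximity g r \<le> nev_proximity g R"
proof (rule le_if_le_add_two_epsilon)
  fix e :: real assume e: "e > 0"
  have "\<forall>\<^sub>F N in sequentially. (\<forall>z\<in>sphere 0 r. \<bar>rotation_mean g N z - nev_proximity g r\<bar> \<le> e) \<and>
     (\<forall>z\<in>sphere 0 R. \<bar>rotation_mean g N z - nev_proximity g R\<bar> \<le> e) \<and> N > 0"
    using r by (intro eventually_conj rotation_mean_approximates continuous_on_subset[OF g(2)]
       e eventually_gt_at_top) auto
  then obtain N where N: "\<forall>z\<in>sphere 0 r. \<bar>rotation_mean g N z - nev_proximity g r\<bar> \<le> e"
     "\<forall>z\<in>sphere 0 R. \<bar>rotation_mean g N z - nev_proximity g R\<bar> \<le> e" "N > 0"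
    by (metis (mono_tags, lifting) eventually_sequentially order_refl)
  define h where "h = (\<lambda>j z. g (cis (2 * pi * real j / real N) * z))"
  have hs: "(\<Sum>j<N. log_plus (norm (h j z))) = N * rotation_mean g N z" for z
    using N(3) by (simp add: h_def rotation_mean_def)
  have "(\<Sum>j<N. log_plus (norm (h j (of_real r)))) \<le> N * (nev_proximity g R + e)"
  proof (rule sum_log_plus_maximum_principle[where U = "ball 0 R"])
    fix j :: nat
    show "h j holomorphic_on ball 0 R" unfolding h_def
      by (rule holomorphic_on_compose_gen[OF _ g(1), unfolded o_def])
         (auto intro!: holomorphic_intros simp: norm_mult)
    show "continuous_on (closure (ball 0 R)) (h j)" unfolding h_def
      using r by (intro continuous_on_compose2[OF g(2)] continuous_intros) (auto simp: norm_mult)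
  next
    fix z :: complex assume "z \<in> frontier (ball 0 R)"
    then have "z \<in> sphere 0 R" using r by simp
    then have "rotation_mean g N z \<le> nev_proximity g R + e" using N(2) by fastforce
    then show "(\<Sum>j<N. log_plus (norm (h j z))) \<le> N * (nev_proximity g R + e)"
      unfolding hs by (intro mult_left_mono) auto
  qed (use r in auto)
  then have "rotation_mean g N (of_real r) \<le> nev_proximity g R + e"
    unfolding hs using N(3) by simp
  moreover have "\<bar>rotation_mean g N (of_real r) - nev_proximity g r\<bar> \<le> e" using N(1) r by simp
  ultimately show "nev_proximity g r \<le> nev_proximity g R + 2 * e" by linarith
qed

lemma nev_proximity_0: "nev_proximity g 0 = log_plus (norm (g 0))"
  by (simp add: nev_proximity_def)

text \<open>The inversion \<open>z \<mapsto> a * b / z\<close> exchanges the two circles. Hence the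
  sum of the rotation means at \<open>z\<close> and at its image is close to the right-hand side on
  the whole frontier of the annulus, and the maximum principle bounds it at the fixed point
  \<open>sqrt (a * b)\<close>.\<close>

lemma nev_proximity_midpoint:
  assumes g: "g holomorphic_on UNIV" and r: "0 < a" "a < b"
  shows "2 * nev_proximity g (sqrt (a * b)) \<le> nev_proximity g a + nev_proximity g b"
proof (rule le_if_le_add_two_epsilon)
  fix e' :: real assume e': "e' > 0"
  define e where "e = e' / 2"
  have e: "e > 0" using e' by (simp add: e_def)
  define r where "r = sqrt (a * b)"
  have rr: "a < r" "r < b" "r * r = a * b"
    using r by (auto simp: r_def intro!: real_less_rsqrt real_less_lsqrt simp: power2_eq_square)
  have cont: "continuous_on S g" for S
    using g by (meson holomorphic_on_imp_continuous_on continuous_on_subset subset_UNIV)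
  have "\<forall>\<^sub>F N in sequentially. (\<forall>z\<in>sphere 0 a. \<bar>rotation_mean g N z - nev_proximity g a\<bar> \<le> e) \<and>
     (\<forall>z\<in>sphere 0 b. \<bar>rotation_mean g N z - nev_proximity g b\<bar> \<le> e) \<and>
     (\<forall>z\<in>sphere 0 r. \<bar>rotation_mean g N z - nev_proximity g r\<bar> \<le> e) \<and> N > 0"
    using r rr by (intro eventually_conj rotation_mean_approximates cont
       e eventually_gt_at_top) auto
  then obtain N where N: "\<forall>z\<in>sphere 0 a. \<bar>rotation_mean g N z - nev_proximity g a\<bar> \<le> e"
     "\<forall>z\<in>sphere 0 b. \<bar>rotation_mean g N z - nev_proximity g b\<bar> \<le> e"
     "\<forall>z\<in>sphere 0 r. \<bar>rotation_mean g N z - nev_proximity g r\<bar> \<le> e" "N > 0"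
    by (metis (mono_tags, lifting) eventually_sequentially order_refl)
  \<comment> \<open>The boolean index chooses between a rotated copy of \<open>g\<close> and the
    same copy composed with the inversion.\<close>
  define h where "h = (\<lambda>(j, d) z. g (cis (2 * pi * real j / real N) *
     (if d then z else of_real (a * b) / z)))"
  let ?J = "{..<N} \<times> (UNIV :: bool set)"
  have hs: "(\<Sum>j\<in>?J. log_plus (norm (h j z))) =
      N * (rotation_mean g N z + rotation_mean g N (of_real (a * b) / z))" for z
  proof -
    have "(\<Sum>j\<in>?J. log_plus (norm (h j z))) = (\<Sum>j<N. \<Sum>d\<in>UNIV. log_plus (norm (h (j, d) z)))"
      by (subst sum.cartesian_product) (simp add: split_def)
    also have "\<dots> = (\<Sum>j<N. log_plus (norm (h (j, True) z)) + log_plus (norm (h (j, False) z)))"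
      by (simp add: UNIV_bool add.commute)
    also have "\<dots> = N * (rotation_mean g N z + rotation_mean g N (of_real (a * b) / z))"
      using N(4) by (simp add: h_def rotation_mean_def sum.distrib distrib_left)
    finally show ?thesis .
  qed
  let ?U = "ball 0 b - cball 0 a :: complex set"
  \<comment> \<open>The closed annulus misses the origin, so the inversion is holomorphic inside and
    continuous up to the frontier.\<close>
  have cl: "closure ?U \<subseteq> cball 0 b - ball 0 a"
    by (rule closure_minimal) (auto intro!: closed_Diff)
  have U: "open ?U" by (auto intro!: open_Diff)
  have nz: "z \<noteq> 0" if "z \<in> closure ?U" for z using cl that r by auto
  have nzU: "z \<noteq> 0" if "z \<in> ?U" for z using that r by auto
  have "(\<Sum>j\<in>?J. log_plus (norm (h j (of_real r)))) \<le>
      N * (nev_proximity g a + nev_proximity g b + 2 * e)"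
  proof (rule sum_log_plus_maximum_principle[where U = ?U])
    fix j :: "nat \<times> bool"
    obtain i d where j: "j = (i, d)" by (cases j)
    let ?k = "\<lambda>z::complex. if d then z else of_real (a * b) / z"
    have "?k holomorphic_on ?U"
      by (cases d; simp del: Diff_iff) (intro holomorphic_on_divide holomorphic_intros nzU)
    then show "h j holomorphic_on ?U" unfolding h_def j prod.case
      by (intro holomorphic_on_compose_gen[OF _ g, unfolded o_def] holomorphic_on_mult) auto
    have "continuous_on (closure ?U) ?k" using nz by (cases d) (auto intro!: continuous_intros)
    then show "continuous_on (closure ?U) (h j)" unfolding h_def j prod.case
      by (intro continuous_on_compose2[OF cont[of UNIV]] continuous_on_mult) auto
  next
    fix z :: complex assume "z \<in> frontier ?U"
    then have "z \<in> cball 0 b - ball 0 a" "z \<notin> ?U"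
      using cl U by (auto simp: frontier_def interior_open)
    then consider "z \<in> sphere 0 a" | "z \<in> sphere 0 b" by force
    then have "rotation_mean g N z + rotation_mean g N (of_real (a * b) / z)
       \<le> nev_proximity g a + nev_proximity g b + 2 * e"
    proof cases
      case 1
      then have "of_real (a * b) / z \<in> sphere 0 b" using r by (simp add: norm_divide norm_mult)
      then show ?thesis using 1 N(1,2) by fastforce
    next
      case 2
      then have "of_real (a * b) / z \<in> sphere 0 a" using r by (simp add: norm_divide norm_mult)
      then show ?thesis using 2 N(1,2) by fastforce
    qed
    then show "(\<Sum>j\<in>?J. log_plus (norm (h j z))) \<le>
        N * (nev_proximity g a + nev_proximity g b + 2 * e)"
      unfolding hs by (intro mult_left_mono) auto
  qed (use r rr U in \<open>auto intro!: bounded_subset[OF bounded_ball]\<close>)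
  \<comment> \<open>At the fixed point of the inversion both rotation means coincide, which produces
    the factor \<open>2\<close>.\<close>
  moreover have "of_real (a * b) / of_real r = (of_real r :: complex)"
    using r rr by (simp add: field_simps flip: of_real_mult)
  ultimately have "2 * rotation_mean g N (of_real r) \<le> nev_proximity g a + nev_proximity g b + 2 * e"
    unfolding hs using N(4) by simp
  moreover have "\<bar>rotation_mean g N (of_real r) - nev_proximity g r\<bar> \<le> e" using N(3) r rr by simp
  ultimately show "2 * nev_proximity g (sqrt (a * b)) \<le> nev_proximity g a + nev_proximity g b + 2 * e'"
    unfolding r_def e_def by argo
qed

section \<open>Comparison of the characteristic with the maximum modulus\<close>

text \<open>The action on angles of the disc automorphism \<open>\<zeta> \<mapsto> (\<zeta> + a) / (1 + cnj a * \<zeta>)\<close>. Substituting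
  it in a circle mean at \<open>0\<close> yields the value at \<open>a\<close>, which replaces the Poisson kernel.\<close>
definition mobius_angle :: "complex \<Rightarrow> real \<Rightarrow> real" where
  "mobius_angle a \<theta> = \<theta> - 2 * Im (Ln (1 + cnj a * cis \<theta>))"

context
  fixes a :: complex
  assumes a: "norm a = 1 / 2"
begin

text \<open>Keeps the denominator in the right half plane, away from zero and from the branch cut of
  \<open>Ln\<close>.\<close>

lemma mobius_denominator:
  "norm (z :: complex) \<le> 1 \<Longrightarrow> Re (1 + cnj a * z) \<ge> 1 / 2"
proof -
  assume "norm z \<le> 1"
  then have "norm (cnj a * z) \<le> 1 / 2" using a mult_left_mono[of "norm z" 1 "norm a"] by (simp add: norm_mult)
  then have "Re (cnj a * z) \<ge> - (1 / 2)" using abs_Re_le_cmod[of "cnj a * z"] by linarith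
  then show ?thesis by simp
qed

text \<open>With \<open>c\<close> the denominator,
  \<open>cis \<theta> + a = cis \<theta> * cnj c\<close> because \<open>cis \<theta>\<close> is
  unimodular, and \<open>cnj c / c\<close> has angle \<open>- 2 * Im (Ln c)\<close>.\<close>

lemma cis_mobius_angle: "cis (mobius_angle a \<theta>) = (cis \<theta> + a) / (1 + cnj a * cis \<theta>)"
proof -
  define c where "c = 1 + cnj a * cis \<theta>"
  have "Re c \<ge> 1 / 2" unfolding c_def by (rule mobius_denominator) simp
  then have c: "c \<noteq> 0" by auto
  define L where "L = Ln c"
  have cL: "exp L = c" using c by (simp add: L_def)
  have cL': "exp (cnj L) = cnj c" by (simp add: cL flip: exp_cnj)
  have "cnj c / c = exp (cnj L - L)" by (simp add: cL cL' exp_diff)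
  also have "cnj L - L = \<i> * of_real (- 2 * Im L)" by (simp add: complex_eq_iff)
  finally have "cnj c / c = cis (- 2 * Im L)" by (simp add: cis_conv_exp)
  then have "cis (mobius_angle a \<theta>) = cis \<theta> * (cnj c / c)"
    by (simp add: mobius_angle_def L_def c_def cis_mult)
  moreover have "cis \<theta> * cnj c = cis \<theta> + a"
    by (simp add: c_def distrib_left cis_cnj cis_mult mult.left_commute)
  ultimately show ?thesis by (simp add: c_def)
qed

text \<open>With \<open>c\<close> the denominator, \<open>D \<theta>\<close> is the Poisson kernel
  \<open>(1 - (norm a)^2) / (norm c)^2\<close>, here \<open>(3 / 4) / (norm c)^2\<close>. The bound
  \<open>norm c \<le> 3 / 2\<close> makes it at least \<open>1 / 3\<close>.\<close>

lemma mobius_angle_deriv: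
  defines "D \<equiv> \<lambda>\<theta>. 2 * Re (1 / (1 + cnj a * cis \<theta>)) - 1"
  shows "(mobius_angle a has_field_derivative D \<theta>) (at \<theta>)"
    and "1 \<le> 3 * D \<theta>"
proof -
  define c where "c = 1 + cnj a * cis \<theta>"
  have Rc: "Re c \<ge> 1 / 2" unfolding c_def by (rule mobius_denominator) simp
  then have c: "c \<noteq> 0" "c \<notin> \<real>\<^sub>\<le>\<^sub>0" by (auto simp: complex_nonpos_Reals_iff)
  have "(cis has_vector_derivative \<i> * cis \<theta>) (at \<theta>)"
    using has_derivative_cis[OF has_derivative_ident, of \<theta>]
    by (simp add: has_vector_derivative_def)
  then have "((\<lambda>\<theta>. 1 + cnj a * cis \<theta>) has_vector_derivative cnj a * (\<i> * cis \<theta>)) (at \<theta>)"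
    by (auto intro!: derivative_eq_intros has_vector_derivative_mult_right)
  from field_vector_diff_chain_at[OF this has_field_derivative_Ln]
  have "((\<lambda>\<theta>. Ln (1 + cnj a * cis \<theta>)) has_vector_derivative cnj a * (\<i> * cis \<theta>) * inverse c) (at \<theta>)"
    using c by (simp add: o_def c_def)
  from bounded_linear.has_vector_derivative[OF bounded_linear_Im this]
  have "((\<lambda>\<theta>. Im (Ln (1 + cnj a * cis \<theta>))) has_field_derivative Im (cnj a * (\<i> * cis \<theta>) * inverse c)) (at \<theta>)"
    by (simp add: has_real_derivative_iff_has_vector_derivative)
  then have "(mobius_angle a has_field_derivative 1 - 2 * Im (cnj a * (\<i> * cis \<theta>) * inverse c)) (at \<theta>)"
    unfolding mobius_angle_def[abs_def]
    by (intro DERIV_diff DERIV_cmult DERIV_ident)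
  moreover have "1 - 2 * Im (cnj a * (\<i> * cis \<theta>) * inverse c) = D \<theta>"
  proof -
    have e: "cnj a * (\<i> * cis \<theta>) * inverse c = \<i> * (1 - 1 / c)"
      using c by (simp add: field_simps) (simp add: c_def algebra_simps)
    show ?thesis unfolding e D_def c_def[symmetric] by simp
  qed
  ultimately show "(mobius_angle a has_field_derivative D \<theta>) (at \<theta>)" by simp
  have n1: "norm (c - 1) = 1 / 2" using a by (simp add: c_def norm_mult)
  have "norm c \<le> norm (c - 1) + norm (1::complex)" using norm_triangle_ineq[of "c - 1" 1] by simp
  then have "norm c \<le> 3 / 2" using n1 by simp
  then have "(norm c)\<^sup>2 \<le> (3 / 2)\<^sup>2" by (intro power_mono) auto
  then have n2: "(norm c)\<^sup>2 \<le> 9 / 4" by (simp add: power2_eq_square)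
  have "(norm (c - 1))\<^sup>2 = 1 / 4" unfolding n1 by (simp add: power2_eq_square)
  moreover have "(norm (c - 1))\<^sup>2 = (norm c)\<^sup>2 - 2 * Re c + 1"
    unfolding cmod_power2 by (simp add: power2_eq_square algebra_simps)
  ultimately have n3: "2 * Re c = (norm c)\<^sup>2 + 3 / 4" by simp
  have "Re (1 / c) = Re c / (norm c)\<^sup>2"
    by (simp add: Re_divide cmod_power2)
  then have "D \<theta> = (2 * Re c - (norm c)\<^sup>2) / (norm c)\<^sup>2"
    using c by (simp add: D_def flip: c_def) (simp add: field_simps)
  also have "\<dots> = (3 / 4) / (norm c)\<^sup>2" using n3 by simp
  also have "\<dots> \<ge> (3 / 4) / (9 / 4)"
    using n2 c by (intro divide_left_mono) auto
  finally show "1 \<le> 3 * D \<theta>" by simp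
qed

text \<open>Substituting \<open>mobius_angle\<close> leads to an integral of \<open>u\<close> over
  an interval of length \<open>2 * pi\<close>, which periodicity identifies with the full circle
  integral. Bounding the derivative below by \<open>1 / 3\<close> costs the factor
  \<open>3\<close>.\<close>

lemma integral_mobius_angle_le:
  fixes u :: "real \<Rightarrow> real"
  assumes u: "continuous_on UNIV u" "\<And>x. u (x + 2 * pi) = u x" "\<And>x. u x \<ge> 0"
  shows "integral {0..2 * pi} (\<lambda>\<theta>. u (mobius_angle a \<theta>)) \<le> 3 * integral {0..2 * pi} u"
proof -
  let ?\<psi> = "mobius_angle a"
  define D where "D = (\<lambda>\<theta>. 2 * Re (1 / (1 + cnj a * cis \<theta>)) - 1)"
  have D: "(?\<psi> has_field_derivative D \<theta>) (at \<theta> within S)" "1 \<le> 3 * D \<theta>" for \<theta> S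
    using mobius_angle_deriv[of \<theta>] by (auto simp: D_def intro: has_field_derivative_at_within)
  \<comment> \<open>The argument of the denominator is below \<open>pi / 2\<close>, so every angle
    moves by less than \<open>pi\<close>.\<close>
  have Ln: "\<bar>Im (Ln (1 + cnj a * cis \<theta>))\<bar> < pi / 2" for \<theta>
    by (rule Re_Ln_pos_lt_imp, rule less_le_trans[OF _ mobius_denominator]) auto
  have bnd: "?\<psi> \<theta> \<in> {\<theta> - pi..\<theta> + pi}" for \<theta>
    using Ln[of \<theta>] by (auto simp: mobius_angle_def)
  have turn: "?\<psi> (2 * pi) = ?\<psi> 0 + 2 * pi" by (simp add: mobius_angle_def)
  have cont\<psi>: "continuous_on S ?\<psi>" for S using D(1) by (rule DERIV_continuous_on)
  have "((\<lambda>x. D x *\<^sub>R u (?\<psi> x)) has_integral integral {?\<psi> 0..?\<psi> (2 * pi)} u) {0..2*pi}"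
  proof (rule has_integral_substitution)
    show "?\<psi> ` {0..2*pi} \<subseteq> {-pi..3*pi}"
    proof safe
      fix x :: real assume "x \<in> {0..2*pi}"
      then show "?\<psi> x \<in> {-pi..3*pi}" using bnd[of x] by auto
    qed
    show "continuous_on {-pi..3*pi} u" using u(1) by (rule continuous_on_subset) auto
  qed (use turn D in auto)
  moreover have "integral {?\<psi> 0..?\<psi> (2 * pi)} u = integral {0..2*pi} u"
    unfolding turn using bnd[of 0] pi_gt_zero by (intro integral_periodic_shift u) auto
  ultimately have I: "((\<lambda>x. 3 * (D x * u (?\<psi> x))) has_integral 3 * integral {0..2*pi} u) {0..2*pi}"
    by (intro has_integral_mult_right) simp
  have "continuous_on {0..2 * pi} (\<lambda>\<theta>. u (?\<psi> \<theta>))"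
    by (rule continuous_on_compose2[OF u(1) cont\<psi>]) auto
  then have "(\<lambda>\<theta>. u (?\<psi> \<theta>)) integrable_on {0..2 * pi}" by (rule integrable_continuous_interval)
  then show ?thesis
  proof (rule has_integral_le[OF integrable_integral I])
    fix x
    show "u (?\<psi> x) \<le> 3 * (D x * u (?\<psi> x))"
      using mult_right_mono[OF D(2)[of x] u(3)[of "?\<psi> x"]] by simp
  qed
qed

end

text \<open>\<open>h\<close> is \<open>g\<close> on the disc of radius \<open>2 * norm z\<close>,
  rescaled to the unit disc and composed with the automorphism taking \<open>0\<close> to
  \<open>a\<close>, so that \<open>h 0 = g z\<close>. Monotonicity bounds the value at the centre by
  the mean over the unit circle, and the change of angle returns to the mean of
  \<open>g\<close>.\<close>

lemma log_plus_le_nev_proximity: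
  assumes g: "g holomorphic_on UNIV"
  shows "log_plus (norm (g z)) \<le> 3 * nev_proximity g (2 * norm z)"
proof (cases "z = 0")
  case True
  then show ?thesis by (simp add: nev_proximity_0)
next
  case False
  define R where "R = 2 * norm z"
  define a where "a = z / of_real R"
  have R: "R > 0" and a: "norm a = 1 / 2" using False by (auto simp: R_def a_def norm_divide)
  define h where "h = (\<lambda>w. g (of_real R * ((w + a) / (1 + cnj a * w))))"
  have nz: "1 + cnj a * w \<noteq> 0" if "w \<in> cball 0 1" for w
    using mobius_denominator[OF a, of w] that by (force simp del: plus_complex.sel)
  have cont: "continuous_on S g" for S
    using g by (meson holomorphic_on_imp_continuous_on continuous_on_subset subset_UNIV)
  have "nev_proximity h 0 \<le> nev_proximity h 1"
  proof (rule nev_proximity_mono)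
    show "h holomorphic_on ball 0 1" unfolding h_def using nz
      by (intro holomorphic_on_compose_gen[OF _ g, unfolded o_def] holomorphic_intros) auto
    show "continuous_on (cball 0 1) h" unfolding h_def using nz
      by (intro continuous_on_compose2[OF cont[of UNIV]] continuous_intros) auto
  qed auto
  moreover have "h 0 = g z" using R by (simp add: h_def a_def)
  ultimately have "log_plus (norm (g z)) \<le> nev_proximity h 1" by (simp add: nev_proximity_0)
  also have "\<dots> = 1 / (2 * pi) *
      integral {0..2 * pi} (\<lambda>\<theta>. log_plus (norm (g (of_real R * cis (mobius_angle a \<theta>)))))"
    by (simp add: nev_proximity_def h_def cis_mobius_angle[OF a])
  also have "\<dots> \<le> 1 / (2 * pi) * (3 * integral {0..2 * pi} (\<lambda>\<theta>. log_plus (norm (g (of_real R * cis \<theta>)))))"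
    using R by (intro mult_left_mono integral_mobius_angle_le[OF a] continuous_on_circle cont)
      (auto simp: cis_add_2pi)
  also have "\<dots> = 3 * nev_proximity g R" by (simp add: nev_proximity_def)
  finally show ?thesis by (simp add: R_def)
qed

section \<open>The characteristic of an entire function\<close>

lemma entire_continuous_on:
  "g holomorphic_on UNIV \<Longrightarrow> continuous_on S g" for g :: "complex \<Rightarrow> complex"
  by (meson holomorphic_on_imp_continuous_on continuous_on_subset subset_UNIV)

lemma nev_counting_no_poles:
  assumes "\<And>z. \<not> is_pole f z"
  shows "nev_counting f r = 0"
  using assms by (simp add: nev_counting_def pole_count_def)

lemma nev_char_entire:
  assumes "g holomorphic_on UNIV"
  shows "nev_char g = nev_proximity g"
  using nev_counting_no_poles[of g] not_is_pole_holomorphic[OF open_UNIV UNIV_I assms]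
  by (auto simp: nev_char_def)

lemma nev_char_entire_mono:
  assumes "g holomorphic_on UNIV" "0 \<le> r" "r \<le> R"
  shows "nev_char g r \<le> nev_char g R"
  using nev_proximity_mono[of g R r] assms entire_continuous_on[OF assms(1)]
    holomorphic_on_subset[OF assms(1)]
  by (cases "r = R") (auto simp: nev_char_entire)

text \<open>Holds for every \<open>f\<close>: when the integrand is not integrable,
  \<open>integral\<close> has the value \<open>0\<close>.\<close>

lemma nev_proximity_nonneg: "0 \<le> nev_proximity f r"
proof (cases "(\<lambda>\<theta>. log_plus (norm (f (of_real r * cis \<theta>)))) integrable_on {0..2 * pi}")
  case True
  then show ?thesis
    by (simp add: nev_proximity_def Henstock_Kurzweil_Integration.integral_nonneg)
qed (simp add: nev_proximity_def not_integrable_integral)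

lemma continuous_on_nev_char_entire:
  assumes "g holomorphic_on UNIV"
  shows "continuous_on S (nev_char g)"
  unfolding nev_char_entire[OF assms] nev_proximity_def[abs_def]
proof (intro continuous_on_mult_left)
  have "continuous_on (UNIV \<times> cbox 0 (2 * pi)) (\<lambda>(r, \<theta>). log_plus (norm (g (of_real r * cis \<theta>))))"
    unfolding split_def
    by (intro continuous_on_log_plus_norm continuous_on_compose2[OF entire_continuous_on[OF assms, of UNIV]]
        continuous_intros) auto
  from integral_continuous_on_param[OF this]
  have "continuous_on UNIV (\<lambda>r. integral {0..2 * pi} (\<lambda>\<theta>. log_plus (norm (g (of_real r * cis \<theta>)))))"
    by simp
  then show "continuous_on S (\<lambda>r. integral {0..2 * pi} (\<lambda>\<theta>. log_plus (norm (g (of_real r * cis \<theta>)))))"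
    by (rule continuous_on_subset) auto
qed

text \<open>The midpoint inequality forbids \<open>nev_char g\<close> to become constant after having increased:
  take the smallest point \<open>c\<close> at which the value is attained.\<close>
lemma nev_char_entire_strict:
  assumes g: "g holomorphic_on UNIV" and xy: "0 < x" "x < y" and v: "nev_char g 1 < nev_char g y"
  shows "nev_char g x < nev_char g y"
proof (rule ccontr)
  let ?T = "nev_char g"
  note mono = nev_char_entire_mono[OF g]
  assume "\<not> ?T x < ?T y"
  then have xv: "?T x = ?T y" using mono[of x y] xy by simp
  have x1: "x > 1"
  proof (rule ccontr)
    assume "\<not> x > 1"
    then show False using mono[of x 1] xy v xv by simp
  qed
  define S where "S = {t\<in>{1..x}. ?T t = ?T y}"
  have "S = {1..x} \<inter> ?T -` {?T y}" by (auto simp: S_def)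
  moreover have "closed ({1..x} \<inter> ?T -` {?T y})"
    by (intro continuous_closed_preimage continuous_on_nev_char_entire g) auto
  ultimately have "closed S" by simp
  moreover have ne: "S \<noteq> {}" "bdd_below S" using xv x1 by (auto simp: S_def)
  ultimately have c: "Inf S \<in> S" by (rule closed_contains_Inf[rotated 2])
  define c where "c = Inf S"
  have c: "c \<in> S" "\<And>t. t \<in> S \<Longrightarrow> c \<le> t"
    using c ne by (auto simp: c_def intro: cInf_lower)
  have c1: "c > 1" "c \<le> x" "?T c = ?T y" using c(1) v by (auto simp: S_def order.order_iff_strict)
  \<comment> \<open>\<open>a\<close> and \<open>b = c\<^sup>2 / a\<close> have geometric mean
    \<open>c\<close>. The entry \<open>1\<close> keeps \<open>a\<close> in the range of
    \<open>S\<close>, the other entry ensures \<open>b \<le> y\<close>. The midpoint inequality then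
    puts \<open>a\<close> into \<open>S\<close> although \<open>a < c\<close>.\<close>
  define a where "a = max 1 (c\<^sup>2 / y)"
  have "c * c < c * y" using c1 xy by (intro mult_strict_left_mono) auto
  then have a: "1 \<le> a" "a < c" "c\<^sup>2 / y \<le> a"
    using c1 xy by (auto simp: a_def power2_eq_square divide_simps)
  define b where "b = c\<^sup>2 / a"
  have b: "a * b = c\<^sup>2" "b \<le> y" "c < b"
    using a c1 xy by (auto simp: b_def field_simps power2_eq_square)
  have "2 * ?T (sqrt (a * b)) \<le> ?T a + ?T b"
    unfolding nev_char_entire[OF g] using a b by (intro nev_proximity_midpoint g) auto
  moreover have "sqrt (a * b) = c" using c1 b by simp
  moreover have "?T b \<le> ?T y" using b c1 by (intro mono) auto
  ultimately have "?T a \<ge> ?T y" using c1 by simp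
  moreover have "?T a \<le> ?T c" using a by (intro mono) auto
  ultimately have "a \<in> S" using a c1 by (simp add: S_def)
  then show False using c(2)[of a] a by simp
qed

section \<open>Bounds between the characteristic and the maximum modulus\<close>

lemma norm_le_max_modulus:
  assumes "continuous_on (sphere 0 r) g" "z \<in> sphere 0 r"
  shows "norm (g z) \<le> max_modulus g r"
proof -
  have "compact ((\<lambda>z. norm (g z)) ` sphere 0 r)"
    by (intro compact_continuous_image continuous_intros assms) auto
  then have "bdd_above ((\<lambda>z. norm (g z)) ` sphere 0 r)"
    by (simp add: compact_imp_bounded bounded_imp_bdd_above)
  then show ?thesis unfolding max_modulus_def using assms(2) by (rule cSUP_upper2) auto
qed

lemma max_modulus_attained:
  assumes "continuous_on (sphere 0 r) g" "0 \<le> r"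
  obtains z where "z \<in> sphere 0 r" "max_modulus g r = norm (g z)"
proof -
  have "compact (sphere 0 r :: complex set)" "(sphere 0 r :: complex set) \<noteq> {}"
    using assms(2) by auto
  then obtain z where z: "z \<in> sphere 0 r" "\<forall>w\<in>sphere 0 r. norm (g w) \<le> norm (g z)"
    using continuous_attains_sup[of "sphere 0 r" "\<lambda>z. norm (g z)"] continuous_on_norm[OF assms(1)] by blast
  then have "max_modulus g r = norm (g z)"
    unfolding max_modulus_def by (intro cSup_eq_maximum) auto
  with z that show ?thesis by blast
qed

lemma nev_char_le_max_modulus:
  assumes g: "g holomorphic_on UNIV" and "0 \<le> r"
  shows "nev_char g r \<le> log_plus (max_modulus g r)"
proof -
  have "integral {0..2 * pi} (\<lambda>\<theta>. log_plus (norm (g (of_real r * cis \<theta>))))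
      \<le> integral {0..2 * pi} (\<lambda>\<theta>. log_plus (max_modulus g r))"
    using circle_in_sphere[OF \<open>0 \<le> r\<close>]
    by (intro integral_le integrable_continuous_interval continuous_on_circle entire_continuous_on[OF g]
        log_plus_mono norm_le_max_modulus continuous_intros \<open>0 \<le> r\<close>) auto
  then show ?thesis by (simp add: nev_char_entire[OF g] nev_proximity_def field_simps)
qed

text \<open>The pointwise bound is applied where the maximum modulus is attained.\<close>

lemma max_modulus_le_nev_char:
  assumes g: "g holomorphic_on UNIV" and "0 \<le> r"
  shows "log_plus (max_modulus g r) \<le> 3 * nev_char g (2 * r)"
proof -
  obtain z where "z \<in> sphere 0 r" "max_modulus g r = norm (g z)"
    using max_modulus_attained[OF entire_continuous_on[OF g] \<open>0 \<le> r\<close>] by blast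
  then show ?thesis using log_plus_le_nev_proximity[OF g, of z] by (simp add: nev_char_entire[OF g])
qed

text \<open>Liouville's theorem supplies a value above any given bound, and the maximum principle
  passes the bound to every larger circle.\<close>

lemma max_modulus_at_top:
  assumes g: "g holomorphic_on UNIV" "\<not> g constant_on UNIV"
  shows "filterlim (max_modulus g) at_top at_top"
  unfolding filterlim_at_top
proof
  fix B :: real
  have "\<exists>z. norm (g z) > B"
  proof (rule ccontr)
    assume "\<nexists>z. norm (g z) > B"
    then have "bounded (range g)" by (auto intro!: boundedI[of _ B] simp: not_less)
    then show False using Liouville_theorem[OF g(1)] g(2) by blast
  qed
  then obtain z where z: "norm (g z) > B" by blast
  have "B \<le> max_modulus g r" if "r > norm z" for r
  proof -
    have "norm (g z) \<le> max_modulus g r"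
    proof (rule maximum_modulus_frontier[of g "ball 0 r"])
      fix w :: complex assume "w \<in> frontier (ball 0 r)"
      then have "w \<in> sphere 0 r" using that norm_ge_zero[of z] by (subst (asm) frontier_ball) linarith+
      then show "norm (g w) \<le> max_modulus g r"
        by (intro norm_le_max_modulus entire_continuous_on g)
    qed (use that g in \<open>auto intro: entire_continuous_on holomorphic_on_subset\<close>)
    then show ?thesis using z by simp
  qed
  then show "\<forall>\<^sub>F r in at_top. B \<le> max_modulus g r"
    by (rule eventually_mono[OF eventually_gt_at_top[of "norm z"]])
qed

lemma nev_char_entire_at_top:
  assumes g: "g holomorphic_on UNIV" "\<not> g constant_on UNIV"
  shows "filterlim (nev_char g) at_top at_top"
proof -
  have "filterlim (\<lambda>r. ln (max_modulus g (r / 2))) at_top at_top"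
    by (intro filterlim_compose[OF ln_at_top] filterlim_compose[OF max_modulus_at_top[OF g]]) real_asymp
  then have *: "filterlim (\<lambda>r. ln (max_modulus g (r / 2)) / 3) at_top at_top"
    using filterlim_tendsto_pos_mult_at_top[OF tendsto_const[of "1 / 3"]] by auto
  show ?thesis
  proof (rule filterlim_at_top_mono[OF *])
    show "\<forall>\<^sub>F r in at_top. ln (max_modulus g (r / 2)) / 3 \<le> nev_char g r"
      using eventually_ge_at_top[of 0]
    proof eventually_elim
      case (elim r)
      have "ln (max_modulus g (r / 2)) \<le> log_plus (max_modulus g (r / 2))"
        by (simp add: log_plus_def)
      also have "\<dots> \<le> 3 * nev_char g r"
        using max_modulus_le_nev_char[OF g(1), of "r / 2"] elim by simp
      finally show ?case by simp
    qed
  qed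
qed

section \<open>Growth of the characteristic under Property (A)\<close>

lemma property_A_entire: "property_A g \<Longrightarrow> g holomorphic_on UNIV" "property_A g \<Longrightarrow> \<not> g constant_on UNIV"
  by (auto simp: property_A_def)

lemma filterlim_powr_at_top: "\<sigma> > 0 \<Longrightarrow> filterlim (\<lambda>r::real. r powr \<sigma>) at_top at_top"
  by real_asymp

text \<open>Property (A) with exponent \<open>sqrt \<sigma>\<close> doubles the logarithm. The
  induction hypothesis is used with the same exponent, and composing the two powers gives exponent
  \<open>\<sigma>\<close>.\<close>

lemma property_A_ln_max_modulus:
  assumes "property_A g" "\<sigma> > 1"
  shows "\<forall>\<^sub>F r in at_top. 2 ^ n * ln (max_modulus g r) \<le> ln (max_modulus g (r powr \<sigma>))"
  using assms(2)
proof (induction n arbitrary: \<sigma>)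
  note M_top = max_modulus_at_top[OF property_A_entire[OF assms(1)]]
  have step: "\<forall>\<^sub>F r in at_top. 2 * ln (max_modulus g r) \<le> ln (max_modulus g (r powr \<tau>))" if "\<tau> > 1" for \<tau>
  proof -
    have "\<forall>\<^sub>F r in at_top. (max_modulus g r)\<^sup>2 \<le> max_modulus g (r powr \<tau>)"
      using assms(1) that by (auto simp: property_A_def)
    moreover have "\<forall>\<^sub>F r in at_top. max_modulus g r > 0"
      using M_top by (simp add: filterlim_at_top_dense)
    ultimately show ?thesis
    proof eventually_elim
      case (elim r)
      have "2 * ln (max_modulus g r) = ln ((max_modulus g r)\<^sup>2)"
        using elim by (simp add: ln_realpow)
      also have "\<dots> \<le> ln (max_modulus g (r powr \<tau>))"
        using elim by (intro ln_mono) (auto simp: zero_less_power)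
      finally show ?case .
    qed
  qed
  {
    case 0
    show ?case
      using step[OF 0] filterlim_at_top_dense[THEN iffD1, OF M_top, rule_format, of 1]
    proof eventually_elim
      case (elim r)
      then have "ln (max_modulus g r) \<ge> 0" by simp
      with elim(1) show ?case unfolding power_0 mult_1 by linarith
    qed
  next
    case (Suc n)
    define \<tau> where "\<tau> = sqrt \<sigma>"
    have \<tau>: "\<tau> > 1" "\<tau> * \<tau> = \<sigma>" using Suc.prems by (auto simp: \<tau>_def)
    have "\<forall>\<^sub>F r in at_top. 2 * ln (max_modulus g (r powr \<tau>)) \<le> ln (max_modulus g ((r powr \<tau>) powr \<tau>))"
      using eventually_compose_filterlim[OF step[OF \<tau>(1)] filterlim_powr_at_top[of \<tau>]] \<tau> by simp
    then show ?case
      using Suc.IH[OF \<tau>(1)]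
    proof eventually_elim
      case (elim r)
      then show ?case by (simp add: powr_powr \<tau>)
    qed
  }
qed

text \<open>The characteristic is at most the logarithm of the maximum modulus, and at least a third
  of it at half the radius. Iterating Property (A) gains a factor \<open>2 ^ n\<close>, which beats
  \<open>3 * K\<close>.\<close>

lemma property_A_nev_char_growth:
  assumes A: "property_A g" and "\<sigma> > 1"
  shows "\<forall>\<^sub>F r in at_top. K * nev_char g r \<le> nev_char g (r powr \<sigma>)"
proof -
  note g = property_A_entire[OF assms(1)]
  obtain n where n: "3 * K < 2 ^ n" using real_arch_pow[of 2 "3 * K"] by auto
  \<comment> \<open>The gap between \<open>\<tau>\<close> and \<open>\<sigma>\<close> absorbs the
    doubling of the radius in the return from the maximum modulus to the characteristic.\<close>
  define \<tau> where "\<tau> = (1 + \<sigma>) / 2"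
  have \<tau>: "\<tau> > 1" "\<tau> < \<sigma>" using assms(2) by (auto simp: \<tau>_def)
  have "\<forall>\<^sub>F r in at_top. 2 * r powr \<tau> \<le> r powr \<sigma>" using \<tau> by real_asymp
  moreover have "\<forall>\<^sub>F r in at_top. max_modulus g r > 1"
    using max_modulus_at_top[OF g] by (simp add: filterlim_at_top_dense)
  ultimately show ?thesis
    using property_A_ln_max_modulus[OF A \<tau>(1), of n] eventually_gt_at_top[of 0]
  proof eventually_elim
    case (elim r)
    have T0: "nev_char g r \<ge> 0" by (simp add: nev_char_entire[OF g(1)] nev_proximity_nonneg)
    have "3 * K * nev_char g r \<le> 2 ^ n * nev_char g r"
      using n T0 by (intro mult_right_mono) auto
    also have "\<dots> \<le> 2 ^ n * ln (max_modulus g r)"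
      using nev_char_le_max_modulus[OF g(1), of r] elim by (simp add: log_plus_eq_ln)
    also have "\<dots> \<le> ln (max_modulus g (r powr \<tau>))" by (rule elim)
    also have "\<dots> \<le> log_plus (max_modulus g (r powr \<tau>))" by (simp add: log_plus_def)
    also have "\<dots> \<le> 3 * nev_char g (2 * r powr \<tau>)"
      by (intro max_modulus_le_nev_char g) auto
    also have "\<dots> \<le> 3 * nev_char g (r powr \<sigma>)"
      using nev_char_entire_mono[OF g(1), of "2 * r powr \<tau>"] elim by simp
    finally show ?case by simp
  qed
qed

section \<open>The characteristic of a meromorphic function\<close>

lemma meromorphic_local_bound:
  assumes "f meromorphic_on {a}"
  obtains C m where "C > 0" "\<forall>\<^sub>F w in at a. norm (f w) \<le> C / norm (w - a) ^ m"
proof (cases "\<exists>\<^sub>F w in at a. f w \<noteq> 0")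
  case False
  then have "\<forall>\<^sub>F w in at a. norm (f w) \<le> 1 / norm (w - a) ^ 0"
    by (auto simp: frequently_def elim: eventually_mono)
  then show ?thesis using that[of 1 0] by simp
next
  case True
  define n where "n = zorder f a"
  define g where "g = zor_poly f a"
  obtain r where r: "r > 0" "g holomorphic_on cball a r"
      "\<And>w. w \<in> cball a r - {a} \<Longrightarrow> f w = g w * (w - a) powi n"
    using zorder_exist[OF _ _ True] assms unfolding meromorphic_at_iff n_def g_def by blast
  have "compact (g ` cball a r)"
    using r(2) by (intro compact_continuous_image holomorphic_on_imp_continuous_on) auto
  then obtain B where B: "B > 0" "\<And>w. w \<in> cball a r \<Longrightarrow> norm (g w) \<le> B"
    using compact_imp_bounded bounded_pos by (metis imageI)
  \<comment> \<open>Within distance \<open>1\<close> nonnegative powers of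
    \<open>norm (w - a)\<close> are at most \<open>1\<close>, so the exponent
    \<open>nat (- n)\<close> covers poles and zeros alike.\<close>
  have "\<forall>\<^sub>F w in at a. w \<in> ball a (min r 1) - {a}"
    using r by (intro eventually_at_in_open) auto
  then have "\<forall>\<^sub>F w in at a. norm (f w) \<le> B / norm (w - a) ^ nat (- n)"
  proof eventually_elim
    case (elim w)
    then have w: "w \<in> cball a r - {a}" "norm (w - a) < 1" "norm (w - a) > 0"
      by (auto simp: dist_norm norm_minus_commute)
    have "norm ((w - a) powi n) \<le> 1 / norm (w - a) ^ nat (- n)"
    proof (cases "n \<ge> 0")
      case True
      then show ?thesis using w by (auto simp: power_int_def norm_power intro: power_le_one)
    next
      case False
      then show ?thesis by (auto simp: power_int_def norm_power norm_inverse divide_inverse power_inverse)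
    qed
    moreover have "norm (g w) \<le> B" using w B by auto
    ultimately have "norm (g w) * norm ((w - a) powi n) \<le> B * (1 / norm (w - a) ^ nat (- n))"
      using B by (intro mult_mono) auto
    then show ?case using r(3)[OF w(1)] by (simp add: norm_mult)
  qed
  with B that show ?thesis by blast
qed

text \<open>The chord is bounded below by \<open>r * \<bar>sin h\<bar>\<close>, and
  \<open>sin h / h\<close> tends to \<open>1\<close>. This turns a pole bound in the plane into one
  in the angle.\<close>

lemma circle_local_expansion:
  assumes "r > 0"
  shows "\<forall>\<^sub>F \<theta> in at \<theta>0. norm (of_real r * cis \<theta> - of_real r * cis \<theta>0) \<ge> r / 2 * \<bar>\<theta> - \<theta>0\<bar>"
proof -
  have "((\<lambda>h. sin h / h) \<longlongrightarrow> 1) (at (0::real))"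
    using DERIV_sin[of "0::real"] by (simp add: DERIV_def)
  from order_tendstoD(1)[OF this, of "1 / 2"]
  have "\<forall>\<^sub>F h in at (0::real). 1 / 2 < sin h / h" by simp
  then have "\<forall>\<^sub>F h in at 0. norm (of_real r * cis (h + \<theta>0) - of_real r * cis \<theta>0) \<ge> r / 2 * \<bar>h + \<theta>0 - \<theta>0\<bar>"
    using eventually_neq_at_within[of 0]
  proof eventually_elim
    case (elim h)
    have "1 / 2 < \<bar>sin h\<bar> / \<bar>h\<bar>" using elim(1) abs_ge_self[of "sin h / h"]
      unfolding abs_divide by linarith
    then have "\<bar>h\<bar> / 2 \<le> \<bar>sin h\<bar>" using elim by (simp add: field_simps)
    also have "\<bar>sin h\<bar> \<le> norm (cis h - 1)" using abs_Im_le_cmod[of "cis h - 1"] by simp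
    finally have "r * (\<bar>h\<bar> / 2) \<le> r * norm (cis h - 1)"
      using assms by (intro mult_left_mono) auto
    also have "\<dots> = norm (of_real r * cis \<theta>0 * (cis h - 1))" using assms by (simp add: norm_mult)
    also have "of_real r * cis \<theta>0 * (cis h - 1) = of_real r * cis (h + \<theta>0) - of_real r * cis \<theta>0"
      by (simp add: algebra_simps flip: cis_mult)
    finally show ?case by simp
  qed
  then show ?thesis by (subst eventually_at_to_0)
qed

text \<open>Transfers properties of a punctured neighbourhood in the plane to the angle.\<close>

lemma filterlim_circle_at:
  assumes "r > 0"
  shows "filterlim (\<lambda>\<theta>. of_real r * cis \<theta>) (at (of_real r * cis \<theta>0)) (at \<theta>0)"
  unfolding filterlim_at
proof
  have "continuous_on UNIV (\<lambda>\<theta>. of_real r * cis \<theta>)" by (intro continuous_intros)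
  then show "((\<lambda>\<theta>. of_real r * cis \<theta>) \<longlongrightarrow> of_real r * cis \<theta>0) (at \<theta>0)"
    by (simp add: continuous_on_eq_continuous_at isCont_def)
  show "\<forall>\<^sub>F \<theta> in at \<theta>0. of_real r * cis \<theta> \<in> UNIV \<and> of_real r * cis \<theta> \<noteq> of_real r * cis \<theta>0"
    using circle_local_expansion[OF assms, of \<theta>0] eventually_neq_at_within[of \<theta>0]
    by eventually_elim (use assms in \<open>auto simp: mult_le_0_iff\<close>)
qed

text \<open>An integrable majorant for logarithmic singularities; the antiderivative is
  \<open>2 * sqrt (x - c)\<close> on the right of \<open>c\<close> and
  \<open>- 2 * sqrt (c - x)\<close> on the left.\<close>

lemma integrable_inverse_sqrt:
  fixes c :: real
  assumes "a \<le> c" "c \<le> b"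
  shows "(\<lambda>x. 1 / sqrt \<bar>x - c\<bar>) integrable_on {a..b}"
proof -
  have "((\<lambda>x. 1 / sqrt \<bar>x - c\<bar>) has_integral (2 * sqrt (b - c) - 2 * sqrt (c - c))) {c..b}"
    using assms
    by (intro fundamental_theorem_of_calculus_interior)
       (auto intro!: continuous_intros derivative_eq_intros
          simp flip: has_real_derivative_iff_has_vector_derivative simp: field_simps)
  moreover have "((\<lambda>x. 1 / sqrt \<bar>x - c\<bar>) has_integral (- 2 * sqrt (c - c) - (- 2 * sqrt (c - a)))) {a..c}"
    using assms
    by (intro fundamental_theorem_of_calculus_interior)
       (auto intro!: continuous_intros derivative_eq_intros
          simp flip: has_real_derivative_iff_has_vector_derivative simp: field_simps)
  ultimately show ?thesis
    using assms by (intro Henstock_Kurzweil_Integration.integrable_combine[of a c b]) (auto simp: integrable_on_def)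
qed

text \<open>The singular term is \<open>- m * ln d\<close>, and
  \<open>- ln d = 2 * ln (1 / sqrt d) \<le> 2 / sqrt d\<close>.\<close>

lemma log_plus_singular_bound:
  assumes "C > 0" "0 < d" "d < 1" "0 \<le> x" "x \<le> C / d ^ m"
  shows "log_plus x \<le> log_plus C + 2 * real m * (1 / sqrt d)"
proof -
  have d1: "d ^ m \<le> 1" "d ^ m > 0" using assms by (auto intro: power_le_one)
  have "max 1 x \<le> max 1 C / d ^ m"
  proof -
    have "C / d ^ m \<le> max 1 C / d ^ m" "1 / d ^ m \<le> max 1 C / d ^ m"
      using d1 by (auto intro!: divide_right_mono)
    moreover have "1 \<le> 1 / d ^ m" using d1 by simp
    ultimately show ?thesis using assms(5) by linarith
  qed
  then have "log_plus x \<le> ln (max 1 C / d ^ m)"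
    unfolding log_plus_eq_ln_max[OF assms(4)] by (intro ln_mono) auto
  also have "\<dots> = log_plus C - real m * ln d"
    using assms d1 by (simp add: log_plus_eq_ln_max ln_div ln_realpow less_max_iff_disj)
  also have "- ln d \<le> 2 * (1 / sqrt d)"
  proof -
    have "- ln d = 2 * ln (1 / sqrt d)" using assms by (simp add: ln_div ln_sqrt)
    also have "ln (1 / sqrt d) \<le> 1 / sqrt d" using assms by (intro ln_bound) auto
    finally show ?thesis by simp
  qed
  then have "log_plus C - real m * ln d \<le> log_plus C + 2 * real m * (1 / sqrt d)"
    using mult_left_mono[of "- ln d" "2 * (1 / sqrt d)" "real m"] by (simp add: mult_ac)
  finally show ?thesis .
qed

text \<open>Near \<open>t\<close>, but off \<open>t\<close>, the integrand is continuous and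
  dominated by a multiple of \<open>1 / sqrt \<bar>\<theta> - t\<bar>\<close> plus a constant. The
  single point \<open>t\<close> is negligible.\<close>

lemma log_plus_meromorphic_locally_integrable:
  assumes f: "f meromorphic_on UNIV" and r: "r > 0"
  obtains d where "d > 0" "\<And>a b. a \<le> t \<Longrightarrow> t \<le> b \<Longrightarrow> b - a < d \<Longrightarrow>
    (\<lambda>\<theta>. log_plus (norm (f (of_real r * cis \<theta>)))) integrable_on {a..b}"
proof -
  let ?u = "\<lambda>\<theta>. log_plus (norm (f (of_real r * cis \<theta>)))"
  let ?c = "\<lambda>\<theta>. of_real r * cis \<theta> :: complex"
  have f': "f meromorphic_on {?c t}" by (rule meromorphic_on_subset[OF f]) auto
  obtain C m where C: "C > 0" "\<forall>\<^sub>F w in at (?c t). norm (f w) \<le> C / norm (w - ?c t) ^ m"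
    using meromorphic_local_bound[OF f'] by blast
  have an: "\<forall>\<^sub>F w in at (?c t). f analytic_on {w}"
    using eventually_cosparse_imp_eventually_at[OF meromorphic_on_imp_analytic_cosparse[OF f]] by blast
  have "\<forall>\<^sub>F \<theta> in at t. norm (f (?c \<theta>)) \<le> C / norm (?c \<theta> - ?c t) ^ m \<and> f analytic_on {?c \<theta>}"
    using eventually_compose_filterlim[OF eventually_conj[OF C(2) an] filterlim_circle_at[OF r]] .
  moreover have "\<forall>\<^sub>F \<theta> in at t. \<theta> \<in> ball t 1 - {t}" by (intro eventually_at_in_open) auto
  ultimately have "\<forall>\<^sub>F \<theta> in at t. isCont ?u \<theta> \<and>
      ?u \<theta> \<le> log_plus (C / (r / 2) ^ m) + 2 * real m * (1 / sqrt \<bar>\<theta> - t\<bar>)"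
    using circle_local_expansion[OF r, of t]
  proof eventually_elim
    case (elim \<theta>)
    have "0 < \<bar>\<theta> - t\<bar>" "\<bar>\<theta> - t\<bar> < 1" using elim by (auto simp: dist_real_def)
    moreover have "norm (f (?c \<theta>)) \<le> C / (r / 2) ^ m / \<bar>\<theta> - t\<bar> ^ m"
    proof -
      have pos: "0 < r / 2 * \<bar>\<theta> - t\<bar>" using r \<open>0 < \<bar>\<theta> - t\<bar>\<close> by simp
      then have "0 < norm (?c \<theta> - ?c t)" using elim(3) by (rule less_le_trans)
      then have "C / norm (?c \<theta> - ?c t) ^ m \<le> C / (r / 2 * \<bar>\<theta> - t\<bar>) ^ m"
        using C(1) pos less_imp_le[OF pos] elim(3)
        by (intro divide_left_mono power_mono mult_pos_pos[of "_ ^ m"] zero_less_power) (assumption | simp)+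
      then have "norm (f (?c \<theta>)) \<le> C / (r / 2 * \<bar>\<theta> - t\<bar>) ^ m" using elim by linarith
      then show ?thesis unfolding power_mult_distrib divide_divide_eq_left .
    qed
    ultimately have "?u \<theta> \<le> log_plus (C / (r / 2) ^ m) + 2 * real m * (1 / sqrt \<bar>\<theta> - t\<bar>)"
      using C r by (intro log_plus_singular_bound) auto
    moreover have "isCont ?u \<theta>"
    proof -
      have "isCont f (?c \<theta>)" using elim by (simp add: analytic_at_imp_isCont)
      then have "isCont (\<lambda>\<theta>. f (?c \<theta>)) \<theta>"
        by (rule isCont_o2[OF continuous_on_interior[of UNIV], rotated 2]) (intro continuous_intros, simp)
      then show ?thesis
        unfolding log_plus_eq_ln_max[OF norm_ge_zero] by (intro continuous_intros) (auto simp: less_max_iff_disj)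
    qed
    ultimately show ?case by blast
  qed
  then obtain d where d: "d > 0" "\<And>\<theta>. \<theta> \<noteq> t \<Longrightarrow> dist \<theta> t < d \<Longrightarrow> isCont ?u \<theta>"
     "\<And>\<theta>. \<theta> \<noteq> t \<Longrightarrow> dist \<theta> t < d \<Longrightarrow> ?u \<theta> \<le> log_plus (C / (r / 2) ^ m) + 2 * real m * (1 / sqrt \<bar>\<theta> - t\<bar>)"
    unfolding eventually_at by blast
  have "?u integrable_on {a..b}" if ab: "a \<le> t" "t \<le> b" "b - a < d" for a b
  proof -
    let ?S = "{a..b} - {t}"
    have near: "\<theta> \<noteq> t" "dist \<theta> t < d" if "\<theta> \<in> ?S" for \<theta> using that ab by (auto simp: dist_real_def)
    have S: "?S \<in> sets lebesgue" by auto
    have spike: "negligible ({a..b} - ?S \<union> (?S - {a..b}))"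
      by (rule negligible_subset[of "{t}"]) auto
    have "?u integrable_on ?S"
    proof (rule measurable_bounded_by_integrable_imp_integrable_real)
      have "continuous_on ?S ?u" using d(2) near by (intro continuous_at_imp_continuous_on) blast
      then show "?u \<in> borel_measurable (lebesgue_on ?S)"
        by (rule continuous_imp_measurable_on_sets_lebesgue) (rule S)
      have "(\<lambda>\<theta>. log_plus (C / (r / 2) ^ m) + 2 * real m * (1 / sqrt \<bar>\<theta> - t\<bar>)) integrable_on {a..b}"
        using integrable_on_mult_right[OF integrable_inverse_sqrt[OF ab(1,2)], of "2 * real m"]
        by (intro integrable_add integrable_const_ivl)
      then show "(\<lambda>\<theta>. log_plus (C / (r / 2) ^ m) + 2 * real m * (1 / sqrt \<bar>\<theta> - t\<bar>)) integrable_on ?S"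
        by (rule integrable_spike_set) (auto intro: negligible_subset[OF spike])
      show "\<bar>?u x\<bar> \<le> log_plus (C / (r / 2) ^ m) + 2 * real m * (1 / sqrt \<bar>x - t\<bar>)" if "x \<in> ?S" for x
        using d(3)[OF near[OF that]] by simp
    qed (rule S)
    then show ?thesis by (rule integrable_spike_set) (auto intro: negligible_subset[OF spike])
  qed
  with d that show ?thesis by blast
qed

text \<open>Local integrability extends to the whole interval by bisection.\<close>

lemma log_plus_meromorphic_integrable:
  assumes f: "f meromorphic_on UNIV" and r: "r > 0"
  shows "(\<lambda>\<theta>. log_plus (norm (f (of_real r * cis \<theta>)))) integrable_on {0..2 * pi}"
proof (rule Bolzano[of 0 "2 * pi" "\<lambda>a b. (\<lambda>\<theta>. log_plus (norm (f (of_real r * cis \<theta>)))) integrable_on {a..b}"])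
  fix t :: real
  show "\<exists>d>0. \<forall>a b. a \<le> t \<and> t \<le> b \<and> b - a < d \<longrightarrow>
     (\<lambda>\<theta>. log_plus (norm (f (of_real r * cis \<theta>)))) integrable_on {a..b}"
    using log_plus_meromorphic_locally_integrable[OF f r, of t] by metis
qed (auto intro: Henstock_Kurzweil_Integration.integrable_combine)

text \<open>Unimodular coefficients cover both signs and also the combinations that recover one
  summand from the sum.\<close>

lemma nev_proximity_add_le:
  assumes f: "f meromorphic_on UNIV" and g: "g meromorphic_on UNIV" and r: "r > 0"
    and ab: "norm a = 1" "norm b = 1"
  shows "nev_proximity (\<lambda>z. a * f z + b * g z) r \<le> nev_proximity f r + nev_proximity g r + ln 2"
proof -
  let ?u = "\<lambda>f \<theta>. log_plus (norm (f (of_real r * cis \<theta>) :: complex))"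
  note I = log_plus_meromorphic_integrable[OF _ r]
  have "integral {0..2 * pi} (?u (\<lambda>z. a * f z + b * g z)) \<le>
      integral {0..2 * pi} (\<lambda>\<theta>. ?u f \<theta> + ?u g \<theta> + ln 2)"
  proof (rule integral_le)
    show "?u (\<lambda>z. a * f z + b * g z) integrable_on {0..2 * pi}"
      by (intro I meromorphic_intros f g)
    show "(\<lambda>\<theta>. ?u f \<theta> + ?u g \<theta> + ln 2) integrable_on {0..2 * pi}"
      by (intro integrable_add integrable_const_ivl I f g)
    fix \<theta> :: real
    let ?z = "of_real r * cis \<theta>"
    have "norm (a * f ?z + b * g ?z) \<le> norm (f ?z) + norm (g ?z)"
      using norm_triangle_ineq[of "a * f ?z" "b * g ?z"] ab by (simp add: norm_mult)
    then show "?u (\<lambda>z. a * f z + b * g z) \<theta> \<le> ?u f \<theta> + ?u g \<theta> + ln 2"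
      by (intro order_trans[OF log_plus_mono log_plus_add_le]) auto
  qed
  also have "\<dots> = integral {0..2 * pi} (?u f) + integral {0..2 * pi} (?u g) + 2 * pi * ln 2"
    using integral_unique[OF has_integral_add[OF has_integral_add[OF
          integrable_integral[OF I[OF f]] integrable_integral[OF I[OF g]]]
          has_integral_const_real[of "ln 2" 0 "2 * pi"]]] by simp
  finally show ?thesis by (simp add: nev_proximity_def field_simps)
qed

section \<open>Pole multiplicities and the counting function\<close>

text \<open>The value \<open>0\<close> off the poles lets sums for several functions run over one
  common finite set.\<close>

definition pole_mult :: "(complex \<Rightarrow> complex) \<Rightarrow> complex \<Rightarrow> nat" where
  "pole_mult f z = (if is_pole f z then nat (- zorder f z) else 0)"

lemma finite_poles:
  assumes "f meromorphic_on UNIV"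
  shows "finite {z \<in> cball 0 r. is_pole f z}"
proof -
  have "{z. is_pole f z} sparse_in UNIV"
    using meromorphic_on_imp_not_pole_cosparse[OF assms] by (simp add: eventually_cosparse)
  then have "{z. is_pole f z} sparse_in cball 0 r" by (rule sparse_in_subset) auto
  from sparse_in_compact_finite[OF this] have "finite (cball 0 r \<inter> {z. is_pole f z})" by simp
  moreover have "cball 0 r \<inter> {z. is_pole f z} = {z \<in> cball 0 r. is_pole f z}" by blast
  ultimately show ?thesis by (simp only:)
qed

lemma pole_mult_pos:
  assumes "f meromorphic_on UNIV" "is_pole f z"
  shows "pole_mult f z > 0"
proof -
  have "f meromorphic_on {z}" by (rule meromorphic_on_subset[OF assms(1)]) simp
  then have "zorder f z < 0"
    using isolated_pole_imp_neg_zorder[OF _ assms(2)] unfolding meromorphic_at_iff by blast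
  then show ?thesis using assms(2) by (simp add: pole_mult_def)
qed

lemma zorder_neg_imp_pole_mult:
  assumes "f meromorphic_on {z}" "\<exists>\<^sub>F w in at z. f w \<noteq> 0"
  shows "nat (- zorder f z) \<le> pole_mult f z"
proof (cases "zorder f z < 0")
  case True
  then have "is_pole f z"
    using neg_zorder_imp_is_pole[of f z] assms unfolding meromorphic_at_iff by blast
  then show ?thesis by (simp add: pole_mult_def)
qed simp

lemma pole_mult_cong:
  assumes "\<forall>\<^sub>F w in at z. f w = g w"
  shows "pole_mult f z = pole_mult g z"
  using is_pole_cong[OF assms refl] zorder_cong[OF assms refl] by (simp add: pole_mult_def)

lemma pole_mult_cmult:
  assumes "f meromorphic_on {z}" "a \<noteq> 0"
  shows "pole_mult (\<lambda>w. a * f w) z \<le> pole_mult f z"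
proof (cases "is_pole f z")
  case True
  then have "\<exists>\<^sub>F w in at z. f w \<noteq> 0"
    using non_zero_neighbour_pole eventually_frequently trivial_limit_at by blast
  moreover have "zorder (\<lambda>w. a * f w) z = zorder f z"
    using zorder_cmult[of a f z] assms by simp
  ultimately show ?thesis using True by (simp add: pole_mult_def)
next
  case False
  have "\<not> is_pole (\<lambda>w. a * f w) z"
  proof
    assume "is_pole (\<lambda>w. a * f w) z"
    from is_pole_cmult_iff[of "inverse a" "\<lambda>w. a * f w" z] this show False
      using False assms by (simp add: mult.assoc[symmetric])
  qed
  then show ?thesis by (simp add: pole_mult_def)
qed

text \<open>The order of a sum is at least the minimum of the orders. Summands vanishing identically
  near \<open>z\<close> are treated apart, since \<open>zorder\<close> carries no information for
  them.\<close>

lemma pole_mult_add_le: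
  assumes f: "f meromorphic_on {z}" and g: "g meromorphic_on {z}"
  shows "pole_mult (\<lambda>w. f w + g w) z \<le> pole_mult f z + pole_mult g z"
proof (cases "is_pole (\<lambda>w. f w + g w) z")
  case False
  then show ?thesis by (simp add: pole_mult_def)
next
  case True
  then have nz: "\<exists>\<^sub>F w in at z. f w + g w \<noteq> 0"
    using non_zero_neighbour_pole eventually_frequently trivial_limit_at by blast
  consider "\<forall>\<^sub>F w in at z. f w = 0" | "\<forall>\<^sub>F w in at z. g w = 0"
    | "\<exists>\<^sub>F w in at z. f w \<noteq> 0" "\<exists>\<^sub>F w in at z. g w \<noteq> 0"
    unfolding frequently_def by (simp only: not_not) blast
  then show ?thesis
  proof cases
    case 1
    then have "\<forall>\<^sub>F w in at z. f w + g w = g w" by eventually_elim simp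
    from pole_mult_cong[OF this] show ?thesis by simp
  next
    case 2
    then have "\<forall>\<^sub>F w in at z. f w + g w = f w" by eventually_elim simp
    from pole_mult_cong[OF this] show ?thesis by simp
  next
    case 3
    have "min (zorder f z) (zorder g z) \<le> zorder (\<lambda>w. f w + g w) z"
      by (rule zorder_add_ge[OF f 3(1) g 3(2) nz]) auto
    then have "nat (- zorder (\<lambda>w. f w + g w) z) \<le> nat (- zorder f z) + nat (- zorder g z)"
      by linarith
    also have "\<dots> \<le> pole_mult f z + pole_mult g z"
      by (intro add_mono zorder_neg_imp_pole_mult f g 3)
    finally show ?thesis using True by (simp add: pole_mult_def)
  qed
qed

text \<open>The contribution of one simple pole at distance \<open>a\<close> from the origin to the
  counting function.\<close>

lemma has_integral_indicator_inverse:
  fixes a r :: real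
  assumes "0 < a" "a \<le> r"
  shows "((\<lambda>t. (if a \<le> t then 1 else 0) / t) has_integral ln (r / a)) {0..r}"
proof -
  have "((\<lambda>t. 1 / t) has_integral (ln r - ln a)) {a..r}"
  proof (rule Henstock_Kurzweil_Integration.fundamental_theorem_of_calculus)
    fix x assume "x \<in> {a..r}"
    then have "(ln has_field_derivative 1 / x) (at x within {a..r})"
      using assms by (intro DERIV_subset[OF DERIV_ln_divide]) auto
    then show "(ln has_vector_derivative 1 / x) (at x within {a..r})"
      by (simp add: has_real_derivative_iff_has_vector_derivative)
  qed (rule assms)
  then have "((\<lambda>t. if t \<in> {a..r} then 1 / t else 0) has_integral ln (r / a)) {0..r}"
    using assms by (subst has_integral_restrict) (auto simp: ln_div)
  then show ?thesis by (rule has_integral_cong[THEN iffD1, rotated]) auto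
qed

text \<open>The pole count is a finite sum of step functions of \<open>t\<close>, integrated term by
  term. \<open>A\<close> may be any finite set containing the nonzero poles in the disc.\<close>

lemma nev_counting_eq_sum:
  assumes f: "f meromorphic_on UNIV" and "0 < r" "finite A" "A \<subseteq> cball 0 r - {0}"
    and A: "\<And>z. z \<in> cball 0 r - {0} \<Longrightarrow> is_pole f z \<Longrightarrow> z \<in> A"
  shows "nev_counting f r = (\<Sum>z\<in>A. real (pole_mult f z) * ln (r / norm z)) + real (pole_mult f 0) * ln r"
proof -
  have c: "pole_count f t = (\<Sum>z\<in>insert 0 A. if norm z \<le> t then pole_mult f z else 0)"
    if "0 \<le> t" "t \<le> r" for t
  proof -
    have "pole_count f t = (\<Sum>z\<in>{z \<in> cball 0 t. is_pole f z}. if norm z \<le> t then pole_mult f z else 0)"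
      unfolding pole_count_def by (intro sum.cong) (auto simp: pole_mult_def)
    also have "\<dots> = (\<Sum>z\<in>insert 0 A. if norm z \<le> t then pole_mult f z else 0)"
    proof (intro sum.mono_neutral_left)
      show "{z \<in> cball 0 t. is_pole f z} \<subseteq> insert 0 A"
      proof
        fix z assume "z \<in> {z \<in> cball 0 t. is_pole f z}"
        then have "norm z \<le> r" "is_pole f z" using that by auto
        then show "z \<in> insert 0 A" using A[of z] by auto
      qed
    qed (use assms(3) in \<open>auto simp: pole_mult_def\<close>)
    finally show ?thesis .
  qed
  have A0: "0 \<notin> A" using assms(4) by auto
  have c0: "pole_count f 0 = pole_mult f 0"
  proof -
    have "(\<Sum>z\<in>A. if norm z \<le> 0 then pole_mult f z else 0) = 0"
      using assms(4) by (intro sum.neutral) auto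
    then show ?thesis using c[of 0] assms A0 by simp
  qed
  have "((\<lambda>t. \<Sum>z\<in>A. real (pole_mult f z) * ((if norm z \<le> t then 1 else 0) / t)) has_integral
     (\<Sum>z\<in>A. real (pole_mult f z) * ln (r / norm z))) {0..r}"
    using assms(3,4) by (intro has_integral_sum has_integral_mult_right has_integral_indicator_inverse) auto
  moreover have "(\<Sum>z\<in>A. real (pole_mult f z) * ((if norm z \<le> t then 1 else 0) / t))
      = (real (pole_count f t) - real (pole_count f 0)) / t" if "t \<in> {0..r}" for t
  proof -
    have "pole_count f t = pole_mult f 0 + (\<Sum>z\<in>A. if norm z \<le> t then pole_mult f z else 0)"
      using c[of t] that assms(3) A0 by simp
    then have "(real (pole_count f t) - real (pole_count f 0)) / t =
       (\<Sum>z\<in>A. real (if norm z \<le> t then pole_mult f z else 0) / t)"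
      by (simp add: c0 sum_divide_distrib)
    then show ?thesis by (auto intro!: sum.cong)
  qed
  ultimately have "((\<lambda>t. (real (pole_count f t) - real (pole_count f 0)) / t) has_integral
     (\<Sum>z\<in>A. real (pole_mult f z) * ln (r / norm z))) {0..r}"
    by (subst has_integral_cong[symmetric]) auto
  then show ?thesis by (simp add: nev_counting_def integral_unique c0)
qed

lemma nev_counting_combination_le:
  assumes f: "f meromorphic_on UNIV" and g: "g meromorphic_on UNIV" and r: "1 \<le> r"
    and ab: "a \<noteq> 0" "b \<noteq> 0"
  shows "nev_counting (\<lambda>z. a * f z + b * g z) r \<le> nev_counting f r + nev_counting g r"
proof -
  define h where "h = (\<lambda>z. a * f z + b * g z)"
  have h: "h meromorphic_on UNIV" unfolding h_def by (intro meromorphic_intros f g)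
  \<comment> \<open>One set serves all three functions. Its weights \<open>ln (r / norm z)\<close>
    are nonnegative, so the inequality of multiplicities can be summed.\<close>
  define A where "A = ({z \<in> cball 0 r. is_pole f z} \<union> {z \<in> cball 0 r. is_pole g z}
      \<union> {z \<in> cball 0 r. is_pole h z}) - {0}"
  have A: "finite A" "A \<subseteq> cball 0 r - {0}" using finite_poles f g h by (auto simp: A_def)
  have eq: "nev_counting k r = (\<Sum>z\<in>A. real (pole_mult k z) * ln (r / norm z)) + real (pole_mult k 0) * ln r"
    if "k \<in> {f, g, h}" for k
    using that f g h r A by (intro nev_counting_eq_sum) (auto simp: A_def)
  have m: "real (pole_mult h z) \<le> real (pole_mult f z) + real (pole_mult g z)" for z
  proof -
    have "f meromorphic_on {z}" "g meromorphic_on {z}"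
      using meromorphic_on_subset[OF f] meromorphic_on_subset[OF g] by auto
    then have "pole_mult h z \<le> pole_mult f z + pole_mult g z"
      unfolding h_def using ab
      by (intro order_trans[OF pole_mult_add_le add_mono] pole_mult_cmult meromorphic_intros) auto
    then show ?thesis by linarith
  qed
  have "nev_counting h r \<le> (\<Sum>z\<in>A. (real (pole_mult f z) + real (pole_mult g z)) * ln (r / norm z))
     + (real (pole_mult f 0) + real (pole_mult g 0)) * ln r"
    unfolding eq[of h, simplified]
  proof (intro add_mono sum_mono mult_right_mono m)
    fix z assume "z \<in> A"
    then have "norm z \<le> r" "0 < norm z" using A by auto
    then show "0 \<le> ln (r / norm z)" by simp
  qed (use r in auto)
  also have "\<dots> = nev_counting f r + nev_counting g r"
    unfolding eq[of f, simplified] eq[of g, simplified] by (simp add: distrib_right sum.distrib)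
  finally show ?thesis by (simp add: h_def)
qed

lemma nev_char_combination_le:
  assumes "f meromorphic_on UNIV" "g meromorphic_on UNIV" "1 \<le> r" "norm a = 1" "norm b = 1"
  shows "nev_char (\<lambda>z. a * f z + b * g z) r \<le> nev_char f r + nev_char g r + ln 2"
proof -
  have "a \<noteq> 0" "b \<noteq> 0" "r > 0" using assms(3-5) by auto
  with nev_counting_combination_le[OF assms(1-3), of a b] nev_proximity_add_le[OF assms(1,2) _ assms(4,5), of r]
  show ?thesis unfolding nev_char_def by linarith
qed

section \<open>Characteristics that are unbounded or constant\<close>

text \<open>A single pole contributes at least \<open>ln (r / norm z)\<close>, or
  \<open>ln r\<close> if it lies at the origin; all other terms are nonnegative for
  \<open>r \<ge> 1\<close>.\<close>

lemma nev_char_pole_at_top: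
  assumes f: "f meromorphic_on UNIV" and z: "is_pole f z"
  shows "filterlim (nev_char f) at_top at_top"
proof (rule filterlim_at_top_mono)
  define b where "b = (if z = 0 then 1 else norm z)"
  have b: "b > 0" by (simp add: b_def)
  have m: "real (pole_mult f z) \<ge> 1" using pole_mult_pos[OF f z] by linarith
  show "filterlim (\<lambda>r. ln (r / b)) at_top at_top"
    using b by real_asymp
  show "\<forall>\<^sub>F r in at_top. ln (r / b) \<le> nev_char f r"
    using eventually_ge_at_top[of "max 1 b"]
  proof eventually_elim
    case (elim r)
    define A where "A = {z \<in> cball 0 r. is_pole f z} - {0}"
    have A: "finite A" "A \<subseteq> cball 0 r - {0}" using finite_poles[OF f] by (auto simp: A_def)
    have r: "1 \<le> r" "b \<le> r" using elim by auto
    have N: "nev_counting f r = (\<Sum>z\<in>A. real (pole_mult f z) * ln (r / norm z)) + real (pole_mult f 0) * ln r"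
      using r A by (intro nev_counting_eq_sum f) (auto simp: A_def)
    have nn: "0 \<le> real (pole_mult f w) * ln (r / norm w)" if "w \<in> A" for w
    proof -
      have "norm w \<le> r" "0 < norm w" using A that by auto
      then show ?thesis by simp
    qed
    have "ln (r / b) \<le> real (pole_mult f z) * ln (r / b)"
      using m r b mult_right_mono[OF m, of "ln (r / b)"] by simp
    also have "\<dots> \<le> nev_counting f r"
    proof (cases "z = 0")
      case True
      then show ?thesis using nn by (auto simp: N b_def intro!: sum_nonneg)
    next
      case False
      then have "z \<in> A" using r z by (auto simp: A_def b_def)
      then have "real (pole_mult f z) * ln (r / norm z) \<le> (\<Sum>z\<in>A. real (pole_mult f z) * ln (r / norm z))"
        using A nn by (intro member_le_sum) auto
      moreover have "0 \<le> real (pole_mult f 0) * ln r" using r by simp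
      ultimately show ?thesis using False by (simp add: N b_def)
    qed
    also have "\<dots> \<le> nev_char f r" using nev_proximity_nonneg[of f r] by (simp add: nev_char_def)
    finally show ?case .
  qed
qed

text \<open>The two functions differ on a set without accumulation points, which meets the circle in
  finitely many angles.\<close>

lemma nev_proximity_remove_sings:
  assumes f: "f meromorphic_on UNIV" and r: "r > 0"
  shows "nev_proximity (remove_sings f) r = nev_proximity f r"
proof -
  let ?c = "\<lambda>\<theta>. of_real r * cis \<theta> :: complex"
  define X where "X = {\<theta>. remove_sings f (?c \<theta>) \<noteq> f (?c \<theta>)}"
  have "\<forall>\<^sub>F \<theta> in at t. remove_sings f (?c \<theta>) = f (?c \<theta>)" for t
    using eventually_compose_filterlim[OF eventually_cosparse_imp_eventually_at[OF eventually_remove_sings_eq[OF f]]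
       filterlim_circle_at[OF r]] by simp
  then have "\<not> t islimpt X" for t
    by (auto simp: islimpt_conv_frequently_at frequently_def X_def)
  then have "finite ({0..2 * pi} \<inter> X)"
    by (intro finite_not_islimpt_in_compact) auto
  then have "integral {0..2 * pi} (\<lambda>\<theta>. log_plus (norm (remove_sings f (?c \<theta>)))) =
     integral {0..2 * pi} (\<lambda>\<theta>. log_plus (norm (f (?c \<theta>))))"
    by (intro integral_spike[OF negligible_finite]) (auto simp: X_def)
  then show ?thesis by (simp add: nev_proximity_def)
qed

text \<open>Without poles, \<open>remove_sings f\<close> is entire and has the same characteristic
  for positive radii.\<close>

lemma nev_char_at_top_or_constant:
  assumes f: "f meromorphic_on UNIV"
  shows "filterlim (nev_char f) at_top at_top \<or> (\<exists>C. \<forall>r>0. nev_char f r = C)"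
proof (cases "\<exists>z. is_pole f z")
  case True
  then show ?thesis using nev_char_pole_at_top[OF f] by blast
next
  case False
  define g where "g = remove_sings f"
  have "g analytic_on UNIV" unfolding g_def
  proof (rule nicely_meromorphic_without_singularities)
    show "remove_sings f nicely_meromorphic_on UNIV" by (rule remove_sings_nicely_meromorphic[OF f])
    show "\<forall>z\<in>UNIV. \<not> is_pole (remove_sings f) z"
      using False is_pole_remove_sings_iff[OF meromorphic_on_isolated_singularity[OF meromorphic_on_subset[OF f]]]
      by blast
  qed
  then have g: "g holomorphic_on UNIV" by (rule analytic_imp_holomorphic)
  have eq: "nev_char f r = nev_char g r" if "r > 0" for r
    using nev_proximity_remove_sings[OF f that] nev_counting_no_poles[of f r] False
    unfolding nev_char_entire[OF g] by (simp add: nev_char_def g_def)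
  show ?thesis
  proof (cases "g constant_on UNIV")
    case True
    then obtain c where "\<And>z. g z = c" by (auto simp: constant_on_def)
    then have "nev_char g r = log_plus (norm c)" for r
      by (simp add: nev_char_entire[OF g] nev_proximity_def)
    then show ?thesis using eq by auto
  next
    case False
    have "filterlim (nev_char f) at_top at_top \<longleftrightarrow> filterlim (nev_char g) at_top at_top"
      by (rule filterlim_cong[OF refl refl]) (rule eventually_mono[OF eventually_gt_at_top[of 0] eq])
    then show ?thesis using nev_char_entire_at_top[OF g False] by blast
  qed
qed

section \<open>Relative growth\<close>

lemma iter_exp_strict_mono: "strict_mono ((exp :: real \<Rightarrow> real) ^^ p)"
  by (induction p) (auto simp: strict_mono_def)

text \<open>Above \<open>(exp ^^ p) 0\<close> every \<open>ln\<close> in the iteration is applied to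
  a positive number.\<close>

lemma iter_exp_iter_log:
  assumes "(exp ^^ p) 0 < X"
  shows "(exp ^^ p) (iter_log p X) = X"
  using assms
proof (induction p arbitrary: X)
  case (Suc p)
  have X: "exp ((exp ^^ p) 0) < X" using Suc.prems by simp
  then have "0 < X" by (rule order.strict_trans[OF exp_gt_zero])
  then have "(exp ^^ p) 0 < ln X" using X by (metis exp_less_cancel_iff exp_ln)
  then have "(exp ^^ p) (iter_log p (ln X)) = ln X" by (rule Suc.IH)
  moreover have "iter_log (Suc p) X = iter_log p (ln X)"
    by (simp add: iter_log_def funpow_Suc_right del: funpow.simps)
  ultimately show ?case using \<open>0 < X\<close> by simp
qed (simp add: iter_log_def)

lemma iter_exp_ge_1: "1 \<le> x \<Longrightarrow> 1 \<le> (exp ^^ p) (x :: real)"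
  by (induction p) (auto intro: order_trans)

lemma iter_exp_pos: "1 \<le> p \<Longrightarrow> 0 < (exp ^^ p) (x :: real)"
  by (cases p) auto

text \<open>Inductively, \<open>\<sigma> \<le> exp (\<sigma> - 1) \<le> exp ((\<sigma> - 1) *
  y)\<close> for \<open>y \<ge> 1\<close>, so that
  \<open>\<sigma> * exp y \<le> exp (\<sigma> * y)\<close>.\<close>

lemma iter_exp_mult_le:
  fixes x \<sigma> :: real
  assumes "1 \<le> \<sigma>" "1 \<le> x"
  shows "\<sigma> * (exp ^^ p) x \<le> (exp ^^ p) (\<sigma> * x)"
proof (induction p)
  case (Suc p)
  define y where "y = (exp ^^ p) x"
  have y: "1 \<le> y" unfolding y_def by (rule iter_exp_ge_1[OF assms(2)])
  have "\<sigma> \<le> exp (\<sigma> - 1)" using exp_ge_add_one_self[of "\<sigma> - 1"] by simp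
  also have "\<dots> \<le> exp ((\<sigma> - 1) * y)" using assms y by (simp add: mult_le_cancel_left1)
  finally have "\<sigma> * exp y \<le> exp ((\<sigma> - 1) * y) * exp y" by (intro mult_right_mono) auto
  also have "\<dots> = exp (\<sigma> * y)" by (simp add: algebra_simps flip: exp_add)
  also have "\<dots> \<le> exp ((exp ^^ p) (\<sigma> * x))" using Suc by (simp add: y_def)
  finally show ?case by (simp add: y_def)
qed simp

text \<open>Below the outermost exponential the power \<open>\<sigma>\<close> becomes a factor
  \<open>\<sigma>\<close>.\<close>

lemma iter_exp_powr_le:
  fixes x \<sigma> :: real
  assumes "1 \<le> p" "1 \<le> \<sigma>" "1 \<le> x"
  shows "(exp ^^ p) x powr \<sigma> \<le> (exp ^^ p) (\<sigma> * x)"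
proof -
  obtain k where k: "p = Suc k" using assms(1) by (cases p) auto
  show ?thesis using iter_exp_mult_le[OF assms(2,3), of k] by (simp add: k powr_def)
qed

lemma iter_exp_at_top: "filterlim ((exp :: real \<Rightarrow> real) ^^ p) at_top at_top"
proof (induction p)
  case (Suc p)
  then show ?case using filterlim_compose[OF exp_at_top Suc] by (simp add: o_def)
qed (simp add: id_def filterlim_ident)

lemma iter_log_at_top: "filterlim (iter_log q) at_top at_top"
proof (induction q)
  case (Suc q)
  then show ?case using filterlim_compose[OF ln_at_top Suc] by (simp add: o_def iter_log_def)
qed (simp add: iter_log_def id_def filterlim_ident)

section \<open>The inverse of the characteristic\<close>

context
  fixes g :: "complex \<Rightarrow> complex"
  assumes g: "g holomorphic_on UNIV" "\<not> g constant_on UNIV"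
begin

text \<open>Existence of a preimage comes from the intermediate value theorem, uniqueness from
  strict growth at values above \<open>nev_char g 1\<close>.\<close>

lemma nev_char_inv:
  assumes y: "nev_char g 1 < y"
  shows "0 < nev_char_inv g y" "nev_char g (nev_char_inv g y) = y"
proof -
  obtain R where R: "R \<ge> 1" "y \<le> nev_char g R"
    using nev_char_entire_at_top[OF g] unfolding filterlim_at_top eventually_at_top_linorder
    by (metis linear order_refl)
  obtain x where x: "1 \<le> x" "x \<le> R" "nev_char g x = y"
    using IVT'[of "nev_char g" 1 y R] y R continuous_on_nev_char_entire[OF g(1)] by auto
  have "x' = x" if "x' > 0" "nev_char g x' = y" for x'
    using nev_char_entire_strict[OF g(1), of x' x] nev_char_entire_strict[OF g(1), of x x']
      that x y by (cases x' x rule: linorder_cases) auto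
  then have "nev_char_inv g y = x"
    unfolding nev_char_inv_def the_inv_into_def using x by (intro the_equality) auto
  then show "0 < nev_char_inv g y" "nev_char g (nev_char_inv g y) = y" using x by auto
qed

lemma nev_char_inv_less_iff:
  assumes y: "nev_char g 1 < y" and R: "0 < R"
  shows "nev_char_inv g y < R \<longleftrightarrow> y < nev_char g R" "R < nev_char_inv g y \<longleftrightarrow> nev_char g R < y"
proof -
  define X where "X = nev_char_inv g y"
  have X: "0 < X" "nev_char g X = y" using nev_char_inv[OF y] by (auto simp: X_def)
  have mono: "nev_char g a \<le> nev_char g b" if "0 < a" "a \<le> b" for a b
    using nev_char_entire_mono[OF g(1)] that by simp
  show "nev_char_inv g y < R \<longleftrightarrow> y < nev_char g R"
    using nev_char_entire_strict[OF g(1) X(1), of R] mono[of X R] mono[of R X] X R y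
    unfolding X_def[symmetric] by (cases "X < R") auto
  show "R < nev_char_inv g y \<longleftrightarrow> nev_char g R < y"
    using nev_char_entire_strict[OF g(1) R, of X] mono[of X R] X R y
    unfolding X_def[symmetric] by (cases "R < X") auto
qed

end

section \<open>Growth ratios expressed by levels of the characteristic\<close>

context
  fixes p q :: nat and \<phi> :: "real \<Rightarrow> real"
  assumes p: "1 \<le> p" and L: "filterlim (\<lambda>r. iter_log q (\<phi> r)) at_top at_top"
begin

text \<open>The threshold that the characteristic of \<open>f\<close> must pass at \<open>r\<close>
  for the growth ratio to exceed \<open>c\<close>.\<close>

definition growth_level :: "(complex \<Rightarrow> complex) \<Rightarrow> real \<Rightarrow> real \<Rightarrow> real" where
  "growth_level g c r = nev_char g ((exp ^^ p) (c * iter_log q (\<phi> r)))"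

abbreviation (input) "lower_order \<equiv> rel_lower_order p q \<phi>"
abbreviation (input) "upper_order \<equiv> rel_order p q \<phi>"

lemma scaled_scale_at_top: "0 < c \<Longrightarrow> filterlim (\<lambda>r. c * iter_log q (\<phi> r)) at_top at_top"
  by (rule filterlim_tendsto_pos_mult_at_top[OF tendsto_const _ L])

lemma growth_radius_at_top: "0 < c \<Longrightarrow> filterlim (\<lambda>r. (exp ^^ p) (c * iter_log q (\<phi> r))) at_top at_top"
  by (rule filterlim_compose[OF iter_exp_at_top scaled_scale_at_top])

lemma growth_level_at_top:
  assumes "property_A g" "0 < c"
  shows "filterlim (growth_level g c) at_top at_top"
  unfolding growth_level_def[abs_def]
  by (rule filterlim_compose[OF nev_char_entire_at_top[OF property_A_entire[OF assms(1)]]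
      growth_radius_at_top[OF assms(2)]])

text \<open>Raising the radius for \<open>c\<close> to the power \<open>d / c\<close> does not
  exceed the radius for \<open>d\<close>, so Property (A) with exponent \<open>d / c\<close>
  applies.\<close>

lemma growth_level_growth:
  assumes A: "property_A g" and cd: "0 < c" "c < d"
  shows "\<forall>\<^sub>F r in at_top. K * growth_level g c r \<le> growth_level g d r"
proof -
  have \<sigma>: "1 < d / c" using cd by simp
  have "\<forall>\<^sub>F r in at_top. 1 \<le> c * iter_log q (\<phi> r)"
    using scaled_scale_at_top[OF cd(1)] by (simp add: filterlim_at_top)
  then show ?thesis
    using eventually_compose_filterlim[OF property_A_nev_char_growth[OF A \<sigma>, of K] growth_radius_at_top[OF cd(1)]]
  proof eventually_elim
    case (elim r)
    let ?x = "c * iter_log q (\<phi> r)"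
    have "K * growth_level g c r \<le> nev_char g ((exp ^^ p) ?x powr (d / c))"
      using elim by (simp add: growth_level_def)
    also have "\<dots> \<le> nev_char g ((exp ^^ p) (d / c * ?x))"
      using iter_exp_powr_le[OF p _ elim(1), of "d / c"] \<sigma>
      by (intro nev_char_entire_mono property_A_entire[OF A]) auto
    also have "d / c * ?x = d * iter_log q (\<phi> r)" using cd by simp
    finally show ?case by (simp add: growth_level_def)
  qed
qed

text \<open>For large \<open>r\<close> the inverse characteristic and the iterated logarithm are
  undone by strictly monotone maps. The bound on \<open>r\<close> is the same for all
  \<open>c\<close>.\<close>

lemma growth_ratio_compare:
  assumes A: "property_A g" and T: "filterlim (nev_char f) at_top at_top"
  shows "\<forall>\<^sub>F r in at_top. 0 < rel_growth_ratio p q \<phi> g f r \<and> (\<forall>c>0.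
    (c < rel_growth_ratio p q \<phi> g f r \<longleftrightarrow> growth_level g c r < nev_char f r) \<and>
    (rel_growth_ratio p q \<phi> g f r < c \<longleftrightarrow> nev_char f r < growth_level g c r))"
proof -
  note g = property_A_entire[OF A]
  \<comment> \<open>The first value makes the inverse meaningful; the second places the preimage
    beyond \<open>(exp ^^ p) 0\<close>, where \<open>iter_log p\<close> is a true inverse.\<close>
  have "\<forall>\<^sub>F r in at_top. max (nev_char g 1) (nev_char g ((exp ^^ p) 0)) < nev_char f r"
    using T unfolding filterlim_at_top_dense by blast
  moreover have "\<forall>\<^sub>F r in at_top. 0 < iter_log q (\<phi> r)"
    using L by (simp add: filterlim_at_top_dense)
  ultimately show ?thesis
  proof eventually_elim
    case (elim r)
    define X where "X = nev_char_inv g (nev_char f r)"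
    define Y where "Y = iter_log p X"
    define l where "l = iter_log q (\<phi> r)"
    have l: "l > 0" using elim by (simp add: l_def)
    have T1: "nev_char g 1 < nev_char f r" using elim by simp
    have X0: "(exp ^^ p) 0 < X"
      using nev_char_inv_less_iff(2)[OF g T1 iter_exp_pos[OF p]] elim by (simp add: X_def)
    have XY: "(exp ^^ p) Y = X" unfolding Y_def by (rule iter_exp_iter_log[OF X0])
    have mono: "(exp ^^ p) a < (exp ^^ p) b \<longleftrightarrow> a < b" for a b :: real
      using iter_exp_strict_mono by (rule strict_mono_less)
    have "0 < Y" using X0 mono[of 0 Y] by (simp add: XY)
    then have "0 < Y / l" using l by simp
    moreover have ratio: "rel_growth_ratio p q \<phi> g f r = Y / l"
      by (simp add: rel_growth_ratio_def X_def Y_def l_def)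
    moreover have "c < Y / l \<longleftrightarrow> growth_level g c r < nev_char f r" for c
    proof -
      have "c < Y / l \<longleftrightarrow> (exp ^^ p) (c * l) < X"
        using l mono[of "c * l" Y] by (simp add: XY pos_less_divide_eq)
      then show ?thesis
        unfolding growth_level_def X_def l_def[symmetric] nev_char_inv_less_iff(2)[OF g T1 iter_exp_pos[OF p]] .
    qed
    moreover have "Y / l < c \<longleftrightarrow> nev_char f r < growth_level g c r" for c
    proof -
      have "Y / l < c \<longleftrightarrow> X < (exp ^^ p) (c * l)"
        using l mono[of Y "c * l"] by (simp add: XY pos_divide_less_eq)
      then show ?thesis
        unfolding growth_level_def X_def l_def[symmetric] nev_char_inv_less_iff(1)[OF g T1 iter_exp_pos[OF p]] .
    qed
    ultimately show ?case by simp
  qed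
qed

context
  fixes f g
  assumes A: "property_A g" and T: "filterlim (nev_char f) at_top at_top"
begin

lemma lower_order_nonneg: "0 \<le> lower_order g f"
  unfolding rel_lower_order_def
  by (rule Liminf_bounded, rule eventually_mono[OF growth_ratio_compare[OF A T]]) auto

lemma less_lower_orderD:
  assumes "0 < c" "ereal c < lower_order g f"
  shows "\<forall>\<^sub>F r in at_top. growth_level g c r < nev_char f r"
  using less_LiminfD[OF assms(2)[unfolded rel_lower_order_def]] growth_ratio_compare[OF A T]
  by eventually_elim (use assms(1) in auto)

lemma lower_order_geI:
  assumes "0 < c" "\<forall>\<^sub>F r in at_top. growth_level g c r \<le> nev_char f r"
  shows "ereal c \<le> lower_order g f"
  unfolding rel_lower_order_def
proof (rule Liminf_bounded)
  show "\<forall>\<^sub>F r in at_top. ereal c \<le> ereal (rel_growth_ratio p q \<phi> g f r)"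
    using assms(2) growth_ratio_compare[OF A T]
    by eventually_elim (use assms(1) in \<open>auto simp flip: not_less\<close>)
qed

text \<open>A lower limit yields only arbitrarily large radii; the upper order below gives all large
  ones.\<close>

lemma lower_order_lessD:
  assumes "0 < c" "lower_order g f < ereal c"
  shows "\<exists>\<^sub>F r in at_top. nev_char f r < growth_level g c r"
  using lower_order_geI[OF assms(1)] assms(2) unfolding frequently_def not_less by auto

lemma upper_order_lessD:
  assumes "0 < c" "upper_order g f < ereal c"
  shows "\<forall>\<^sub>F r in at_top. nev_char f r < growth_level g c r"
  using Limsup_lessD[OF assms(2)[unfolded rel_order_def]] growth_ratio_compare[OF A T]
  by eventually_elim (use assms(1) in auto)

end

text \<open>Otherwise the numerator of the growth ratio is constant while its denominator tends to
  infinity, and the lower order is \<open>0\<close>.\<close>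

lemma nev_char_at_top_if_lower_order_nonzero:
  assumes f: "f meromorphic_on UNIV" and nz: "lower_order g f \<noteq> 0"
  shows "filterlim (nev_char f) at_top at_top"
proof (rule ccontr)
  assume "\<not> filterlim (nev_char f) at_top at_top"
  then obtain C where C: "\<And>r. r > 0 \<Longrightarrow> nev_char f r = C"
    using nev_char_at_top_or_constant[OF f] by blast
  define k where "k = iter_log p (nev_char_inv g C)"
  have "((\<lambda>r. k / iter_log q (\<phi> r)) \<longlongrightarrow> 0) at_top"
    by (rule tendsto_divide_0[OF tendsto_const filterlim_at_top_imp_at_infinity[OF L]])
  moreover have "\<forall>\<^sub>F r in at_top. k / iter_log q (\<phi> r) = rel_growth_ratio p q \<phi> g f r"
    by (rule eventually_mono[OF eventually_gt_at_top[of 0]]) (simp add: C k_def rel_growth_ratio_def)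
  ultimately have "(rel_growth_ratio p q \<phi> g f \<longlongrightarrow> 0) at_top"
    by (rule Lim_transform_eventually)
  then have "((\<lambda>r. ereal (rel_growth_ratio p q \<phi> g f r)) \<longlongrightarrow> ereal 0) at_top" by simp
  from lim_imp_Liminf[OF _ this] nz show False
    by (simp add: rel_lower_order_def zero_ereal_def)
qed

section \<open>Sums of meromorphic functions with a fixed base\<close>

text \<open>Regularity of \<open>h\<close> puts its characteristic below level \<open>c\<close> for
  all large \<open>r\<close> as soon as \<open>c\<close> exceeds its lower order. Hence
  \<open>h\<close> is negligible against \<open>f\<close>, and likewise in the bound of
  \<open>F\<close> by \<open>f\<close> and \<open>h\<close>.\<close>

lemma lower_order_sum:
  assumes A: "property_A g" and T: "filterlim (nev_char f) at_top at_top" "filterlim (nev_char h) at_top at_top"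
    and F: "\<And>r. 1 \<le> r \<Longrightarrow> nev_char F r \<le> nev_char f r + nev_char h r + ln 2"
      "\<And>r. 1 \<le> r \<Longrightarrow> nev_char f r \<le> nev_char F r + nev_char h r + ln 2"
    and less: "lower_order g h < lower_order g f" and reg: "regular_rel_growth p q \<phi> g h"
  shows "filterlim (nev_char F) at_top at_top" and "lower_order g F = lower_order g f"
proof -
  have reg: "upper_order g h = lower_order g h" using reg by (simp add: regular_rel_growth_def)
  have h0: "0 \<le> lower_order g h" by (rule lower_order_nonneg[OF A T(2)])
  have level_ge: "\<forall>\<^sub>F r in at_top. ln 2 \<le> growth_level g c r" if "0 < c" for c
    using growth_level_at_top[OF A that] by (simp add: filterlim_at_top)
  have below: "\<forall>\<^sub>F r in at_top. growth_level g c r \<le> nev_char F r"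
    if c: "lower_order g h < ereal c" "ereal c < lower_order g f" for c
  proof -
    \<comment> \<open>The characteristic of \<open>h\<close> is below level \<open>b\<close>, hence
      below level \<open>c\<close>; that of \<open>f\<close> is above level \<open>d\<close>, hence
      above three times level \<open>c\<close>. Subtracting \<open>h\<close> and \<open>ln 2\<close>
      leaves one copy of level \<open>c\<close>.\<close>
    obtain b where b: "lower_order g h < ereal b" "ereal b < ereal c" using ereal_dense2[OF c(1)] by blast
    obtain d where d: "ereal c < ereal d" "ereal d < lower_order g f" using ereal_dense2[OF c(2)] by blast
    have pos: "0 < b" "b < c" "c < d" using h0 b d by (auto dest: le_less_trans)
    have c0: "0 < c" "0 < d" using pos by auto
    show ?thesis
      using less_lower_orderD[OF A T(1) c0(2) d(2)] upper_order_lessD[OF A T(2) pos(1) b(1)[folded reg]]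
        growth_level_growth[OF A pos(1,2), of 1] growth_level_growth[OF A c0(1) pos(3), of 3]
        level_ge[OF c0(1)] eventually_ge_at_top[of 1]
    proof eventually_elim
      case (elim r)
      then show ?case using F(2)[of r] by simp
    qed
  qed
  obtain c where c: "lower_order g h < ereal c" "ereal c < lower_order g f" using ereal_dense2[OF less] by blast
  have c0: "0 < c" using h0 c(1) by (auto dest: le_less_trans)
  show TF: "filterlim (nev_char F) at_top at_top"
    by (rule filterlim_at_top_mono[OF growth_level_at_top[OF A c0] below[OF c]])
  show "lower_order g F = lower_order g f"
  proof (rule antisym)
    show "lower_order g f \<le> lower_order g F"
    proof (rule ccontr)
      assume "\<not> ?thesis"
      then have "max (lower_order g F) (lower_order g h) < lower_order g f" using less by simp
      then obtain c where c: "max (lower_order g F) (lower_order g h) < ereal c" "ereal c < lower_order g f"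
        using ereal_dense2 by blast
      then have c': "lower_order g h < ereal c" "lower_order g F < ereal c" by auto
      have "0 < c" using h0 c'(1) by (auto dest: le_less_trans)
      from lower_order_geI[OF A TF this below[OF c'(1) c(2)]] show False using c'(2) by simp
    qed
    show "lower_order g F \<le> lower_order g f"
    proof (rule ccontr)
      assume "\<not> ?thesis"
      then have "lower_order g f < lower_order g F" by simp
      then obtain d where d: "lower_order g f < ereal d" "ereal d < lower_order g F" using ereal_dense2 by blast
      obtain c where c: "lower_order g f < ereal c" "ereal c < ereal d" using ereal_dense2[OF d(1)] by blast
      have hc: "lower_order g h < ereal c" using less c(1) by (rule less_trans)
      have pos: "0 < c" "c < d" "0 < d" using h0 hc c(2) by (auto dest: le_less_trans)
      \<comment> \<open>If \<open>F\<close> had the larger lower order, subtracting \<open>h\<close>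
        and \<open>ln 2\<close> from three copies of level \<open>c\<close> would leave
        \<open>f\<close> above level \<open>c\<close> for all large \<open>r\<close>.\<close>
      have "\<forall>\<^sub>F r in at_top. \<not> nev_char f r < growth_level g c r"
        using less_lower_orderD[OF A TF pos(3) d(2)] upper_order_lessD[OF A T(2) pos(1) hc[folded reg]]
          growth_level_growth[OF A pos(1,2), of 3] level_ge[OF pos(1)] eventually_ge_at_top[of 1]
      proof eventually_elim
        case (elim r)
        then show ?case using F(1)[of r] by simp
      qed
      then show False using lower_order_lessD[OF A T(1) pos(1) c(1)] by (simp add: frequently_def)
    qed
  qed
qed

section \<open>Sums of base functions with a fixed meromorphic function\<close>

context
  fixes F G g1 g2
  assumes A: "property_A g1" "property_A g2" "property_A G"
    and TF: "filterlim (nev_char F) at_top at_top"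
begin

text \<open>At the radius for \<open>c\<close> each of the two base characteristics and
  \<open>ln 2\<close> is at most a third of the characteristic of \<open>F\<close>.\<close>

lemma lower_order_base_sum_ge:
  assumes G: "\<And>r. 1 \<le> r \<Longrightarrow> nev_char G r \<le> nev_char g1 r + nev_char g2 r + ln 2"
  shows "min (lower_order g1 F) (lower_order g2 F) \<le> lower_order G F"
proof (rule ccontr)
  assume "\<not> ?thesis"
  then have "lower_order G F < min (lower_order g1 F) (lower_order g2 F)" by (simp only: not_le)
  then obtain d where d: "lower_order G F < ereal d" "ereal d < min (lower_order g1 F) (lower_order g2 F)"
    using ereal_dense2 by blast
  obtain c where c: "lower_order G F < ereal c" "ereal c < ereal d" using ereal_dense2[OF d(1)] by blast
  have d12: "ereal d < lower_order g1 F" "ereal d < lower_order g2 F" using d(2) by auto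
  have pos: "0 < c" "c < d" "0 < d"
    using lower_order_nonneg[OF A(3) TF] c by (auto dest: le_less_trans)
  have "\<forall>\<^sub>F r in at_top. 3 * ln 2 \<le> nev_char F r" using TF by (simp add: filterlim_at_top)
  moreover have "\<forall>\<^sub>F r in at_top. 1 \<le> (exp ^^ p) (c * iter_log q (\<phi> r))"
    using growth_radius_at_top[OF pos(1)] by (simp add: filterlim_at_top)
  ultimately have "\<forall>\<^sub>F r in at_top. growth_level G c r \<le> nev_char F r"
    using less_lower_orderD[OF A(1) TF pos(3) d12(1)] less_lower_orderD[OF A(2) TF pos(3) d12(2)]
      growth_level_growth[OF A(1) pos(1,2), of 3] growth_level_growth[OF A(2) pos(1,2), of 3]
  proof eventually_elim
    case (elim r)
    have "growth_level G c r \<le> growth_level g1 c r + growth_level g2 c r + ln 2"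
      unfolding growth_level_def by (rule G[OF elim(2)])
    then show ?case using elim by simp
  qed
  from lower_order_geI[OF A(3) TF pos(1) this] show False using c(1) by simp
qed

text \<open>If \<open>G\<close> also had a larger lower order than \<open>g1\<close>, then at the
  radius for \<open>d\<close> the characteristic of \<open>g1\<close> would be below three times
  that of \<open>F\<close>; passing from \<open>d\<close> to \<open>c\<close> removes the factor
  \<open>3\<close>.\<close>

lemma lower_order_base_sum_le:
  assumes G: "\<And>r. 1 \<le> r \<Longrightarrow> nev_char g1 r \<le> nev_char G r + nev_char g2 r + ln 2"
    and less: "lower_order g1 F < lower_order g2 F"
  shows "lower_order G F \<le> lower_order g1 F"
proof (rule ccontr)
  assume "\<not> ?thesis"
  then have "lower_order g1 F < min (lower_order G F) (lower_order g2 F)" using less by simp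
  then obtain d where d: "lower_order g1 F < ereal d" "ereal d < min (lower_order G F) (lower_order g2 F)"
    using ereal_dense2 by blast
  obtain c where c: "lower_order g1 F < ereal c" "ereal c < ereal d" using ereal_dense2[OF d(1)] by blast
  have d12: "ereal d < lower_order G F" "ereal d < lower_order g2 F" using d(2) by auto
  have pos: "0 < c" "c < d" "0 < d"
    using lower_order_nonneg[OF A(1) TF] c by (auto dest: le_less_trans)
  have "\<forall>\<^sub>F r in at_top. ln 2 \<le> nev_char F r" using TF by (simp add: filterlim_at_top)
  moreover have "\<forall>\<^sub>F r in at_top. 1 \<le> (exp ^^ p) (d * iter_log q (\<phi> r))"
    using growth_radius_at_top[OF pos(3)] by (simp add: filterlim_at_top)
  ultimately have "\<forall>\<^sub>F r in at_top. \<not> nev_char F r < growth_level g1 c r"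
    using less_lower_orderD[OF A(3) TF pos(3) d12(1)] less_lower_orderD[OF A(2) TF pos(3) d12(2)]
      growth_level_growth[OF A(1) pos(1,2), of 3]
  proof eventually_elim
    case (elim r)
    have "growth_level g1 d r \<le> growth_level G d r + growth_level g2 d r + ln 2"
      unfolding growth_level_def by (rule G[OF elim(2)])
    then show ?case using elim by simp
  qed
  then show False using lower_order_lessD[OF A(1) TF pos(1) c(1)] by (simp add: frequently_def)
qed

end

end

section \<open>Bounds for both signs and the resulting comparison of lower orders\<close>

lemma mono_unbounded_at_top:
  fixes \<phi> :: "real \<Rightarrow> real"
  assumes "mono_on {0..} \<phi>" "\<not> bdd_above (\<phi> ` {0..})"
  shows "filterlim \<phi> at_top at_top"
  unfolding filterlim_at_top
proof
  fix B
  obtain x where x: "0 \<le> x" "B < \<phi> x"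
    using assms(2) unfolding bdd_above_def by (metis atLeast_iff imageE not_le)
  show "\<forall>\<^sub>F r in at_top. B \<le> \<phi> r"
    using eventually_ge_at_top[of x]
  proof eventually_elim
    case (elim r)
    then have "\<phi> x \<le> \<phi> r" using x by (intro mono_onD[OF assms(1)]) auto
    then show ?case using x by simp
  qed
qed

text \<open>Since \<open>s * s = 1\<close>, the summands are recovered as
  \<open>f1 = F - s * f2\<close> and \<open>f2 = s * F - s * f1\<close>, again with unimodular
  coefficients.\<close>

lemma nev_char_sum_bounds:
  fixes s :: complex
  assumes f: "f1 meromorphic_on UNIV" "f2 meromorphic_on UNIV" and s: "s \<in> {1, -1}" and r: "1 \<le> r"
  defines "F \<equiv> \<lambda>z. f1 z + s * f2 z"
  shows "nev_char F r \<le> nev_char f1 r + nev_char f2 r + ln 2"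
    and "nev_char f1 r \<le> nev_char F r + nev_char f2 r + ln 2"
    and "nev_char f2 r \<le> nev_char F r + nev_char f1 r + ln 2"
proof -
  have F: "F meromorphic_on UNIV" unfolding F_def by (intro meromorphic_intros f)
  have n: "norm s = 1" "norm (- s) = 1" "norm (1::complex) = 1" using s by auto
  have eq: "(\<lambda>z. 1 * f1 z + s * f2 z) = F" "(\<lambda>z. 1 * F z + (- s) * f2 z) = f1"
    "(\<lambda>z. s * F z + (- s) * f1 z) = f2"
    using s by (auto simp: F_def)
  show "nev_char F r \<le> nev_char f1 r + nev_char f2 r + ln 2"
    using nev_char_combination_le[OF f r n(3,1)] unfolding eq .
  show "nev_char f1 r \<le> nev_char F r + nev_char f2 r + ln 2"
    using nev_char_combination_le[OF F f(2) r n(3,2)] unfolding eq .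
  show "nev_char f2 r \<le> nev_char F r + nev_char f1 r + ln 2"
    using nev_char_combination_le[OF F f(1) r n(1,2)] unfolding eq .
qed

theorem theorem6:
  fixes p q :: nat
    and \<phi> :: "real \<Rightarrow> real"
    and f g :: "nat \<Rightarrow> complex \<Rightarrow> complex"
    and s t :: complex
  defines "lam \<equiv> rel_lower_order p q \<phi>"
    and "fpm \<equiv> (\<lambda>z. f 1 z + s * f 2 z)"
    and "gpm \<equiv> (\<lambda>z. g 1 z + t * g 2 z)"
  assumes "p \<ge> 1" and "q \<ge> 1"
    and "\<forall>x\<ge>0. \<phi> x > 0" and "mono_on {0..} \<phi>" and "\<not> bdd_above (\<phi> ` {0..})"
    and "s \<in> {1, -1}" and "t \<in> {1, -1}"
    and "\<forall>i\<in>{1,2}. f i meromorphic_on UNIV"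
    and "\<forall>k\<in>{1,2}. g k holomorphic_on UNIV"
    and "property_A (g 1)" and "property_A (g 2)" and "property_A gpm"
    and "\<forall>k\<in>{1,2}. \<forall>i\<in>{1,2}. finite_nonzero (lam (g k) (f i))"
    and "finite_nonzero (lam gpm fpm)"
    and "\<exists>i\<in>{1,2}. \<exists>j\<in>{1,2}. i \<noteq> j \<and> lam (g 1) (f i) > lam (g 1) (f j)
           \<and> regular_rel_growth p q \<phi> (g 1) (f j)"
    and "\<exists>i\<in>{1,2}. \<exists>j\<in>{1,2}. i \<noteq> j \<and> lam (g 2) (f i) > lam (g 2) (f j)
           \<and> regular_rel_growth p q \<phi> (g 2) (f j)"
  shows "lam gpm fpm \<ge> min (max (lam (g 1) (f 1)) (lam (g 1) (f 2)))
                             (max (lam (g 2) (f 1)) (lam (g 2) (f 2)))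
    \<and> ((\<exists>i\<in>{1,2}. \<exists>j\<in>{1,2}. i \<noteq> j \<and> lam (g i) (f 1) < lam (g j) (f 1)
                                     \<and> lam (g i) (f 2) < lam (g j) (f 2))
        \<longrightarrow> lam gpm fpm = min (max (lam (g 1) (f 1)) (lam (g 1) (f 2)))
                               (max (lam (g 2) (f 1)) (lam (g 2) (f 2))))"
proof -
  note p = \<open>p \<ge> 1\<close> and s = \<open>s \<in> {1, -1}\<close> and t = \<open>t \<in> {1, -1}\<close>
    and A = \<open>property_A (g 1)\<close> \<open>property_A (g 2)\<close> \<open>property_A gpm\<close>
  have L: "filterlim (\<lambda>r. iter_log q (\<phi> r)) at_top at_top"
    by (rule filterlim_compose[OF iter_log_at_top mono_unbounded_at_top])
       (rule \<open>mono_on {0..} \<phi>\<close>, rule \<open>\<not> bdd_above (\<phi> ` {0..})\<close>)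
  have f: "f 1 meromorphic_on UNIV" "f 2 meromorphic_on UNIV"
    using \<open>\<forall>i\<in>{1,2}. f i meromorphic_on UNIV\<close> by simp_all
  have g: "g 1 meromorphic_on UNIV" "g 2 meromorphic_on UNIV"
    using A(1,2)[THEN property_A_entire(1)]
    by (auto intro!: analytic_on_imp_meromorphic_on simp: analytic_on_open)
  \<comment> \<open>Nonzero lower orders exclude constant characteristics.\<close>
  have "lam (g 1) (f 1) \<noteq> 0" "lam (g 1) (f 2) \<noteq> 0"
    using \<open>\<forall>k\<in>{1,2}. \<forall>i\<in>{1,2}. finite_nonzero (lam (g k) (f i))\<close> by (simp_all add: finite_nonzero_def)
  then have T: "filterlim (nev_char (f 1)) at_top at_top" "filterlim (nev_char (f 2)) at_top at_top"
    using nev_char_at_top_if_lower_order_nonzero[OF p L] f unfolding lam_def by blast+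
  note F = nev_char_sum_bounds[OF f s, folded fpm_def]
  note G = nev_char_sum_bounds[OF g t, folded gpm_def]
  \<comment> \<open>A general base \<open>k\<close> serves both conditions; the regular summand of
    smaller lower order takes the role of \<open>h\<close> in
    \<open>lower_order_sum\<close>.\<close>
  have sum: "filterlim (nev_char fpm) at_top at_top \<and> lam k fpm = max (lam k (f 1)) (lam k (f 2))"
    if k: "property_A k" and ex: "\<exists>i\<in>{1,2}. \<exists>j\<in>{1,2}. i \<noteq> j \<and> lam k (f i) > lam k (f j)
        \<and> regular_rel_growth p q \<phi> k (f j)" for k
  proof -
    consider "lam k (f 2) < lam k (f 1)" "regular_rel_growth p q \<phi> k (f 2)"
      | "lam k (f 1) < lam k (f 2)" "regular_rel_growth p q \<phi> k (f 1)"
      using ex by auto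
    then show ?thesis
    proof cases
      case 1
      note * = lower_order_sum[OF p L k T F(1,2) 1(1)[unfolded lam_def] 1(2)]
      then show ?thesis using 1(1) by (simp add: lam_def)
    next
      case 2
      have F': "nev_char fpm r \<le> nev_char (f 2) r + nev_char (f 1) r + ln 2" if "1 \<le> r" for r
        using F(1)[OF that] by simp
      note * = lower_order_sum[OF p L k T(2,1) F' F(3) 2(1)[unfolded lam_def] 2(2)]
      then show ?thesis using 2(1) by (simp add: lam_def)
    qed
  qed
  have TF: "filterlim (nev_char fpm) at_top at_top"
    and l1: "lam (g 1) fpm = max (lam (g 1) (f 1)) (lam (g 1) (f 2))"
    using sum[OF A(1)] assms by blast+
  have l2: "lam (g 2) fpm = max (lam (g 2) (f 1)) (lam (g 2) (f 2))"
    using sum[OF A(2)] assms by blast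
  have ge: "min (lam (g 1) fpm) (lam (g 2) fpm) \<le> lam gpm fpm"
    unfolding lam_def by (rule lower_order_base_sum_ge[OF p L A TF G(1)])
  have le1: "lam gpm fpm \<le> lam (g 1) fpm" if "lam (g 1) fpm < lam (g 2) fpm"
    using lower_order_base_sum_le[OF p L A TF G(2)] that unfolding lam_def by blast
  have le2: "lam gpm fpm \<le> lam (g 2) fpm" if "lam (g 2) fpm < lam (g 1) fpm"
    using lower_order_base_sum_le[OF p L A(2,1,3) TF G(3)] that unfolding lam_def by blast
  show ?thesis
    unfolding l1[symmetric] l2[symmetric]
  proof (intro conjI impI ge)
    assume "\<exists>i\<in>{1,2}. \<exists>j\<in>{1,2}. i \<noteq> j \<and> lam (g i) (f 1) < lam (g j) (f 1)
                                     \<and> lam (g i) (f 2) < lam (g j) (f 2)"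
    then consider "lam (g 1) (f 1) < lam (g 2) (f 1)" "lam (g 1) (f 2) < lam (g 2) (f 2)"
      | "lam (g 2) (f 1) < lam (g 1) (f 1)" "lam (g 2) (f 2) < lam (g 1) (f 2)"
      by auto
    then show "lam gpm fpm = min (lam (g 1) fpm) (lam (g 2) fpm)"
    proof cases
      case 1
      \<comment> \<open>Strict inequality in both entries passes to the maxima, so the two lower
        orders of \<open>fpm\<close> differ and the upper bound applies to the smaller one.\<close>
      then have less: "lam (g 1) fpm < lam (g 2) fpm" unfolding l1 l2 by (auto simp: less_max_iff_disj)
      show ?thesis by (rule antisym[OF _ ge]) (use le1[OF less] less in simp)
    next
      case 2
      then have less: "lam (g 2) fpm < lam (g 1) fpm" unfolding l1 l2 by (auto simp: less_max_iff_disj)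
      show ?thesis by (rule antisym[OF _ ge]) (use le2[OF less] less in simp)
    qed
  qed
qed

end
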